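(* Let $n\ge 2$ be an integer and let $G$ be a finite simple graph without odd components, with $g=|V(G)|$. Suppose that for any two (distinct) non-adjacent vertices $u$ and $v$ of $G$, \[ |\,N_G(u)\cup N_G(v)\,|>\max\Bigl\{\,\frac{g-2}{2n}-1,\ \frac{2g-4}{4n+1},\ \frac{g-1}{2n+1},\ 4n-3\,\Bigr\}. \] Then $G$ contains an $H_n$-factor.
   Context: For an integer $n\ge 2$, an $H_n$-factor of a graph $G$ is a spanning subgraph $F$ of $G$ such that $d_F(v)\in\{1,3,5,\ldots,2n-1,2n\}$ for every vertex $v\in V(G)$, where $d_F(v)$ is the degree of $v$ in $F$. $N_G(v)$ denotes the set of neighbors of $v$ in $G$. An odd component is a connected component with an odd number of vertices. *)

theory Defs
  imports Complex_Main "Graph_Theory.Digraph_Component"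
begin

text \<open>
  A finite simple graph is an instance of the locale \<^locale>\<open>graph\<close>: a finite, symmetric digraph
  without loops or parallel arcs, in which every undirected edge is represented by its two
  opposite arcs.
\<close>

definition neighbours :: "('a, 'b) pre_digraph \<Rightarrow> 'a \<Rightarrow> 'a set" where
  "neighbours G v = {w. v \<rightarrow>\<^bsub>G\<^esub> w}"

text \<open>
  The qualified name \<^const>\<open>Digraph_Component.connected\<close> avoids the topological constant of the
  same name. The null graph is not connected, so components are non-empty.
\<close>

definition components :: "('a, 'b) pre_digraph \<Rightarrow> ('a, 'b) pre_digraph set" where
  "components G = {C. pre_digraph.max_subgraph G Digraph_Component.connected C}"

definition odd_components :: "('a, 'b) pre_digraph \<Rightarrow> ('a, 'b) pre_digraph set" where
  "odd_components G = {C \<in> components G. odd (card (verts C))}"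

definition H_degrees :: "nat \<Rightarrow> nat set" where
  "H_degrees n = {d. odd d \<and> d \<le> 2 * n - 1} \<union> {2 * n}"

text \<open>
  Requiring \<^term>\<open>graph F\<close> makes \<^term>\<open>F\<close> an undirected subgraph: it contains both arcs of an edge or
  neither. Each edge at \<^term>\<open>v\<close> then contributes exactly one out-arc, so the degree of \<^term>\<open>v\<close> is its
  out-degree (the in- and out-degree do not have to be added).
\<close>

definition H_factor :: "nat \<Rightarrow> ('a, 'b) pre_digraph \<Rightarrow> ('a, 'b) pre_digraph \<Rightarrow> bool" where
  "H_factor n G F \<longleftrightarrow>
    graph F \<and> spanning F G \<and> (\<forall>v \<in> verts G. out_degree F v \<in> H_degrees n)"

end

theory Submission
  imports Defs
begin

text \<open>
  The degrees \<open>1, 3, \<dots>, 2 n - 1\<close> alone are governed by a theorem of Tutte type: a graph has a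
  factor with odd degrees at most \<open>2 n - 1\<close> if and only if deleting any vertex set \<open>S\<close> leaves at
  most \<open>(2 n - 1) |S|\<close> odd components. Sufficiency is proved here for arbitrary prescribed parities
  and upper bounds (\<open>parity_factor_exists\<close>).

  In general, take a set \<open>S\<close> for which the number of odd components of \<open>G - S\<close> exceeds
  \<open>(2 n - 1) |S|\<close> by as much as possible, and choose it inclusion-maximal. Every even component of
  \<open>G - S\<close> then has an odd factor, and every odd component has one as soon as one extra edge from
  an arbitrary vertex of it to \<open>S\<close> is supplied (\<open>strict_barrier_critical\<close>). So each odd component
  must either be attached to a vertex of \<open>S\<close> or have an \<open>H\<close>-factor of its own. Maximality implies
  that any \<open>X \<subseteq> S\<close> has at least \<open>(2 n - 1) |X|\<close> odd components as neighbours. If,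
  moreover, any set \<open>Y\<close> of odd components without an \<open>H\<close>-factor satisfies \<open>|Y| \<le> 2 n |N(Y)|\<close>,
  where \<open>N(Y)\<close> is its neighbourhood in \<open>S\<close>, then a matching argument (\<open>loads_between_bounds\<close>)
  attaches all those components such that every vertex of \<open>S\<close> receives \<open>2 n - 1\<close> or \<open>2 n\<close> of them.
  Both numbers are admissible degrees, which yields the factor (\<open>H_subgraph_of_barrier\<close>).

  The condition on neighbourhoods guarantees \<open>|Y| \<le> 2 n |N(Y)|\<close> (\<open>barrier_upper_load\<close>):
  otherwise, vertices in the two smallest members of \<open>Y\<close> have too few neighbours if
  \<open>|N(Y)| \<ge> 2\<close>. If \<open>|N(Y)| = 1\<close>, the second smallest member is a complete graph with at least
  \<open>2 n + 1\<close> vertices, which has an \<open>H\<close>-factor consisting of a star and a perfect matching.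
\<close>

section \<open>Components as minimal closed sets\<close>

text \<open>
  A graph is a symmetric relation \<^term>\<open>E\<close>, and a vertex set \<^term>\<open>V\<close> stands for the subgraph that it
  induces. Components are described without paths: they are the atoms of the Boolean algebra of
  vertex sets that no edge leaves. This makes it immediate how they change when vertices are
  deleted, because being closed is the only part of the notion that depends on \<^term>\<open>V\<close>.
\<close>

definition closed_in :: "('a \<times> 'a) set \<Rightarrow> 'a set \<Rightarrow> 'a set \<Rightarrow> bool" where
  "closed_in E V C \<longleftrightarrow> C \<subseteq> V \<and> (\<forall>x y. (x, y) \<in> E \<longrightarrow> x \<in> C \<longrightarrow> y \<in> V \<longrightarrow> y \<in> C)"

definition conn :: "('a \<times> 'a) set \<Rightarrow> 'a set \<Rightarrow> bool" where
  "conn E C \<longleftrightarrow> C \<noteq> {} \<and> (\<forall>D. closed_in E C D \<longrightarrow> D \<noteq> {} \<longrightarrow> D = C)"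

definition comps :: "('a \<times> 'a) set \<Rightarrow> 'a set \<Rightarrow> 'a set set" where
  "comps E V = {C. conn E C \<and> closed_in E V C}"

text \<open>
  For a constant odd weight \<^term>\<open>f\<close> these are the components of odd order; the general weight makes
  an induction possible in which the prescribed degrees are lowered.
\<close>

definition ocomps :: "('a \<times> 'a) set \<Rightarrow> ('a \<Rightarrow> nat) \<Rightarrow> 'a set \<Rightarrow> 'a set set" where
  "ocomps E f V = {C \<in> comps E V. odd (sum f C)}"

lemma closed_in_trans:
  assumes "closed_in E V D" "C \<subseteq> D"
  shows "closed_in E D C \<longleftrightarrow> closed_in E V C"
  using assms unfolding closed_in_def by blast

lemma closed_in_Diff:
  assumes "sym E" "closed_in E V C" "closed_in E V D"
  shows "closed_in E V (C - D)"
  using assms unfolding closed_in_def sym_def by blast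

lemma closed_in_Int:
  assumes "closed_in E V D" "closed_in E U C" "U \<subseteq> V"
  shows "closed_in E U (C \<inter> D)"
  using assms unfolding closed_in_def by blast

lemma closed_in_self [simp]: "closed_in E V V"
  by (auto simp: closed_in_def)

lemma comps_subset: "C \<in> comps E V \<Longrightarrow> C \<subseteq> V"
  by (auto simp: comps_def closed_in_def)

lemma comps_nonempty: "C \<in> comps E V \<Longrightarrow> C \<noteq> {}"
  by (auto simp: comps_def conn_def)

lemma finite_comps: "finite V \<Longrightarrow> finite (comps E V)"
  by (rule finite_subset[of _ "Pow V"]) (auto dest: comps_subset)

lemma finite_ocomps: "finite V \<Longrightarrow> finite (ocomps E f V)"
  by (simp add: ocomps_def finite_comps)

lemma comps_closedD: "C \<in> comps E V \<Longrightarrow> (x, y) \<in> E \<Longrightarrow> x \<in> C \<Longrightarrow> y \<in> V \<Longrightarrow> y \<in> C"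
  unfolding comps_def closed_in_def by blast

text \<open>A component cannot be cut by a closed set, since its trace on the component is closed.\<close>

lemma comps_closed_cases:
  assumes "C \<in> comps E V" "closed_in E V D"
  shows "C \<subseteq> D \<or> C \<inter> D = {}"
proof -
  have "closed_in E C (C \<inter> D)"
    using closed_in_Int[OF assms(2) closed_in_self comps_subset[OF assms(1)]] by simp
  then show ?thesis using assms(1) unfolding comps_def conn_def by blast
qed

lemma comps_disjoint:
  assumes "C \<in> comps E V" "D \<in> comps E V" "C \<noteq> D"
  shows "C \<inter> D = {}"
proof -
  have "closed_in E V C" "closed_in E V D" using assms by (auto simp: comps_def)
  then show ?thesis
    using comps_closed_cases[OF assms(1), of D] comps_closed_cases[OF assms(2), of C] assms(3) by blast
qed

text \<open>
  A closed set of least cardinality containing \<^term>\<open>x\<close> is a component, for a smaller closed set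
  inside it, or else its complement, would contain \<^term>\<open>x\<close>.
\<close>

lemma comps_cover:
  assumes "sym E" "finite V" "x \<in> V"
  obtains C where "C \<in> comps E V" "x \<in> C"
proof -
  obtain C where C: "closed_in E V C" "x \<in> C"
    and min: "\<And>D. closed_in E V D \<Longrightarrow> x \<in> D \<Longrightarrow> card C \<le> card D"
    using ex_has_least_nat[of "\<lambda>C. closed_in E V C \<and> x \<in> C" V card] assms(3) by auto
  have fC: "finite C" using C(1) assms(2) unfolding closed_in_def by (meson finite_subset)
  have "D = C" if D: "closed_in E C D" "D \<noteq> {}" for D
  proof -
    have DC: "D \<subseteq> C" using D(1) by (simp add: closed_in_def)
    have cD: "closed_in E V D" using D(1) closed_in_trans[OF C(1) DC] by simp
    show ?thesis
    proof (cases "x \<in> D")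
      case True
      then show ?thesis using min[OF cD] DC fC by (simp add: card_seteq)
    next
      case False
      then have "card C \<le> card (C - D)"
        using min[OF closed_in_Diff[OF assms(1) C(1) cD]] C(2) by simp
      then show ?thesis
        using card_seteq[OF fC, of "C - D"] D(2) DC by blast
    qed
  qed
  then have "C \<in> comps E V" using C by (auto simp: comps_def conn_def)
  then show thesis using that C(2) by blast
qed

lemma Union_comps: "sym E \<Longrightarrow> finite V \<Longrightarrow> \<Union>(comps E V) = V"
  using comps_cover[of E V] comps_subset[of _ E V] by blast

lemma comps_closed_in:
  assumes "closed_in E V D"
  shows "comps E D = {C \<in> comps E V. C \<subseteq> D}"
proof -
  have "C \<subseteq> D" if "closed_in E D C" for C using that by (simp add: closed_in_def)
  then show ?thesis using closed_in_trans[OF assms] unfolding comps_def by blast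
qed

lemma comps_conn: "C \<in> comps E V \<Longrightarrow> comps E C = {C}"
  unfolding comps_def conn_def closed_in_def by blast

lemma comps_Un:
  assumes "sym E" "closed_in E V D"
  shows "comps E V = comps E D \<union> comps E (V - D)"
  using comps_closed_in[OF assms(2)] comps_closed_in[OF closed_in_Diff[OF assms(1) closed_in_self assms(2)]]
    comps_closed_cases[OF _ assms(2)] comps_subset[of _ E V] by blast

text \<open>The reason is that \<^term>\<open>K - T\<close> is closed in \<^term>\<open>V - T\<close> and its complement there is \<^term>\<open>V - K\<close>.\<close>

lemma comps_delete:
  assumes "sym E" "K \<in> comps E V" "T \<subseteq> K"
  shows "comps E (V - T) = comps E (K - T) \<union> (comps E V - {K})"
    and "comps E (K - T) \<inter> (comps E V - {K}) = {}"
proof -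
  have K: "closed_in E V K" "K \<subseteq> V" using assms(2) by (auto simp: comps_def closed_in_def)
  have 1: "closed_in E (V - T) (K - T)" using K by (auto simp: closed_in_def)
  have "V - T - (K - T) = V - K" using assms(3) by auto
  then have 2: "comps E (V - T) = comps E (K - T) \<union> comps E (V - K)"
    using comps_Un[OF assms(1) 1] by simp
  have "comps E V = {K} \<union> comps E (V - K)"
    using comps_Un[OF assms(1) K(1)] comps_conn[OF assms(2)] by simp
  moreover have "K \<notin> comps E (V - K)"
    using comps_subset[of K E "V - K"] comps_nonempty[OF assms(2)] by auto
  ultimately have 3: "comps E V - {K} = comps E (V - K)" by auto
  show "comps E (V - T) = comps E (K - T) \<union> (comps E V - {K})" using 2 3 by simp
  show "comps E (K - T) \<inter> (comps E V - {K}) = {}"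
    unfolding 3 using comps_subset[of _ E "K - T"] comps_subset[of _ E "V - K"] comps_nonempty[of _ E "K - T"]
    by blast
qed

lemma ocomps_delete:
  assumes "sym E" "finite V" "K \<in> comps E V" "T \<subseteq> K"
  shows "card (ocomps E f (V - T)) = card (ocomps E f (K - T)) + card (ocomps E f V - {K})"
proof -
  have "ocomps E f (V - T) = ocomps E f (K - T) \<union> (ocomps E f V - {K})"
    using comps_delete(1)[OF assms(1,3,4)] by (auto simp: ocomps_def)
  moreover have "ocomps E f (K - T) \<inter> (ocomps E f V - {K}) = {}"
    using comps_delete(2)[OF assms(1,3,4)] by (auto simp: ocomps_def)
  moreover have "finite K" using comps_subset[OF assms(3)] assms(2) by (rule finite_subset)
  ultimately show ?thesis
    using finite_ocomps[of "K - T" E f] finite_ocomps[OF assms(2), of E f] by (simp add: card_Un_disjoint)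
qed

lemma sum_comps:
  fixes f :: "'a \<Rightarrow> nat"
  assumes "sym E" "finite V"
  shows "sum f V = (\<Sum>C\<in>comps E V. sum f C)"
proof -
  have "sum f (\<Union>(comps E V)) = (sum \<circ> sum) f (comps E V)"
    using assms(2) comps_subset[of _ E V] comps_disjoint[of _ E V]
    by (intro sum.Union_disjoint) (auto intro: finite_subset)
  then show ?thesis using Union_comps[OF assms] by simp
qed

text \<open>The total weight is the sum over the components, and only the odd ones count modulo 2.\<close>

lemma ocomps_parity:
  fixes f :: "'a \<Rightarrow> nat"
  assumes "sym E" "finite V"
  shows "even (sum f V + card (ocomps E f V))"
proof -
  have fin: "finite (comps E V)" using assms(2) by (rule finite_comps)
  have "even (sum f V) \<longleftrightarrow> even (card (ocomps E f V))"
    unfolding sum_comps[OF assms, of f] ocomps_def using fin by (simp add: even_sum_iff)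
  then show ?thesis by simp
qed

definition deg :: "('a \<times> 'a) set \<Rightarrow> 'a \<Rightarrow> nat" where
  "deg F v = card (F `` {v})"

section \<open>Gluing subgraphs of the components\<close>

definition subgraph_on :: "('a \<times> 'a) set \<Rightarrow> 'a set \<Rightarrow> ('a \<times> 'a) set \<Rightarrow> bool" where
  "subgraph_on E V F \<longleftrightarrow> F \<subseteq> E \<inter> V \<times> V \<and> sym F"

text \<open>
  Both existence proofs below build their factor in this shape: a subgraph inside every component
  of \<^term>\<open>V - S\<close>, together with one edge from each component in \<^term>\<open>A\<close> to a vertex of \<^term>\<open>S\<close>. The extra
  edge raises one degree in the component by 1, and a vertex of \<^term>\<open>S\<close> gets as its degree the number
  of components that were sent to it.
\<close>

lemma glue_components:
  assumes "sym E" "finite V" "S \<subseteq> V"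
    and Fc: "\<And>C. C \<in> comps E (V - S) \<Longrightarrow> subgraph_on E C (Fc C)"
    and A: "A \<subseteq> comps E (V - S)"
    and att: "\<And>C. C \<in> A \<Longrightarrow> \<sigma> C \<in> S \<and> x C \<in> C \<and> (x C, \<sigma> C) \<in> E"
  obtains F where "subgraph_on E V F"
    and "\<And>C v. C \<in> comps E (V - S) \<Longrightarrow> v \<in> C \<Longrightarrow>
           deg F v = deg (Fc C) v + (if C \<in> A \<and> v = x C then 1 else 0)"
    and "\<And>s. s \<in> S \<Longrightarrow> deg F s = card {C \<in> A. \<sigma> C = s}"
proof -
  define F where "F = (\<Union>C\<in>comps E (V - S). Fc C) \<union> (\<Union>C\<in>A. {(x C, \<sigma> C), (\<sigma> C, x C)})"
  have FcD: "a \<in> C" "b \<in> C" "(a, b) \<in> E" "(b, a) \<in> Fc C" if "C \<in> comps E (V - S)" "(a, b) \<in> Fc C" for C a b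
    using Fc[OF that(1)] that(2) unfolding subgraph_on_def sym_def by auto
  have attE: "(\<sigma> C, x C) \<in> E" if "C \<in> A" for C
    using att[OF that] assms(1) by (meson symD)
  have sub: "C \<subseteq> V" "C \<inter> S = {}" if "C \<in> comps E (V - S)" for C
    using comps_subset[OF that] by auto
  have same: "C = D" if "C \<in> comps E (V - S)" "D \<in> comps E (V - S)" "v \<in> C" "v \<in> D" for C D v
    using comps_disjoint[OF that(1,2)] that(3,4) by blast
  have "F \<subseteq> E \<inter> V \<times> V"
  proof
    fix p assume "p \<in> F"
    then consider C where "C \<in> comps E (V - S)" "p \<in> Fc C"
      | C where "C \<in> A" "p = (x C, \<sigma> C) \<or> p = (\<sigma> C, x C)"
      unfolding F_def by blast
    then show "p \<in> E \<inter> V \<times> V"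
    proof cases
      case 1
      then show ?thesis using Fc[OF 1(1)] sub(1)[OF 1(1)] unfolding subgraph_on_def by blast
    next
      case 2
      then show ?thesis using att[OF 2(1)] attE[OF 2(1)] sub(1)[of C] A assms(3) by blast
    qed
  qed
  moreover have "sym F"
    unfolding F_def sym_def using FcD(4) by blast
  ultimately have 1: "subgraph_on E V F" by (simp add: subgraph_on_def)
  have 2: "deg F v = deg (Fc C) v + (if C \<in> A \<and> v = x C then 1 else 0)"
    if C: "C \<in> comps E (V - S)" "v \<in> C" for C v
  proof -
    have vS: "v \<notin> S" using sub(2)[OF C(1)] C(2) by blast
    have xC: "D = C" if "D \<in> A" "v = x D" for D
      using att[OF that(1)] same[of D C v] C that A by blast
    have e: "F `` {v} = Fc C `` {v} \<union> (if C \<in> A \<and> v = x C then {\<sigma> C} else {})"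
    proof (rule set_eqI)
      fix w
      have "(\<exists>D\<in>comps E (V - S). (v, w) \<in> Fc D) \<longleftrightarrow> (v, w) \<in> Fc C"
        using FcD(1) same C by blast
      moreover have "(\<exists>D\<in>A. (v, w) = (x D, \<sigma> D) \<or> (v, w) = (\<sigma> D, x D)) \<longleftrightarrow> (C \<in> A \<and> v = x C \<and> w = \<sigma> C)"
        using xC vS att by blast
      ultimately show "w \<in> F `` {v} \<longleftrightarrow> w \<in> Fc C `` {v} \<union> (if C \<in> A \<and> v = x C then {\<sigma> C} else {})"
        unfolding F_def by auto
    qed
    have f: "Fc C `` {v} \<subseteq> C" using FcD(2)[OF C(1)] by blast
    have "finite (Fc C `` {v})"
      using f sub(1)[OF C(1)] assms(2) by (meson finite_subset)
    moreover have "C \<in> A \<Longrightarrow> \<sigma> C \<notin> Fc C `` {v}" using f att sub(2)[OF C(1)] by blast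
    ultimately show ?thesis unfolding deg_def e by auto
  qed
  have 3: "deg F s = card {C \<in> A. \<sigma> C = s}" if s: "s \<in> S" for s
  proof -
    have "F `` {s} = x ` {C \<in> A. \<sigma> C = s}"
    proof -
      have "(s, w) \<notin> Fc D" if "D \<in> comps E (V - S)" for D w
        using FcD(1)[OF that] sub(2)[OF that] s by blast
      moreover have "s \<noteq> x D" if "D \<in> A" for D using att[OF that] sub(2)[of D] A that s by blast
      ultimately show ?thesis unfolding F_def by auto
    qed
    moreover have "inj_on x {C \<in> A. \<sigma> C = s}"
      using att same A by (intro inj_onI) (metis (mono_tags, lifting) mem_Collect_eq subsetD)
    ultimately show ?thesis by (simp add: deg_def card_image)
  qed
  show thesis using that[OF 1 2 3] by blast
qed

section \<open>Assignments with prescribed loads\<close>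

text \<open>
  The sets are shrunk one element at a time. If neither of two elements \<open>a\<close>, \<open>b\<close> could be removed
  from \<open>A i\<close>, both removals would create violating index sets \<open>J\<close> and \<open>K\<close>, and
  submodularity of the size of a union turns these into a violation of the original condition.
  When all sets are singletons, the condition says that they are distinct.
\<close>

theorem hall_marriage:
  fixes A :: "'i \<Rightarrow> 'a set"
  assumes "finite I" "\<And>i. i \<in> I \<Longrightarrow> finite (A i)"
    and "\<And>J. J \<subseteq> I \<Longrightarrow> card J \<le> card (\<Union>i\<in>J. A i)"
  obtains r where "inj_on r I" "\<And>i. i \<in> I \<Longrightarrow> r i \<in> A i"
  using assms
proof (induction "\<Sum>i\<in>I. card (A i)" arbitrary: A thesis rule: less_induct)
  case less
  note fin = less.prems(3) and hall = less.prems(4)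
  have finU: "finite (\<Union>i\<in>J. A i)" if "J \<subseteq> I" for J
    using fin finite_subset[OF that \<open>finite I\<close>] that by auto
  show ?case
  proof (cases "\<exists>i\<in>I. card (A i) \<ge> 2")
    case False
    have one: "card (A i) = 1" if "i \<in> I" for i
    proof -
      have "1 \<le> card (A i)" using hall[of "{i}"] that by simp
      moreover have "\<not> 2 \<le> card (A i)" using False that by blast
      ultimately show ?thesis by linarith
    qed
    then obtain r where r: "\<And>i. i \<in> I \<Longrightarrow> A i = {r i}"
    proof -
      have "\<forall>i\<in>I. \<exists>a. A i = {a}"
      proof
        fix i assume "i \<in> I"
        then have "card (A i) = 1" by (rule one)
        then show "\<exists>a. A i = {a}" by (rule card_1_singletonE) (rule exI)
      qed
      then have "\<exists>r. \<forall>i\<in>I. A i = {r i}" by (rule bchoice)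
      then show thesis using that by (elim exE) simp
    qed
    have "inj_on r I"
    proof (rule inj_onI, rule ccontr)
      fix i j assume ij: "i \<in> I" "j \<in> I" "r i = r j" "i \<noteq> j"
      then have "(\<Union>k\<in>{i,j}. A k) = {r i}" using r by auto
      then show False using hall[of "{i, j}"] ij by simp
    qed
    then show ?thesis using less.prems(1) r by blast
  next
    case True
    then obtain i where i: "i \<in> I" "card (A i) \<ge> 2" by blast
    obtain a b where ab: "a \<in> A i" "b \<in> A i" "a \<noteq> b"
      using card_le_Suc0_iff_eq[OF fin[OF i(1)]] i(2) by auto
    define B where "B c = A(i := A i - {c})" for c
    have B_same: "(\<Union>j\<in>J. B c j) = (\<Union>j\<in>J. A j)" if "i \<notin> J" for c J
    proof (rule SUP_cong[OF refl])
      fix j assume "j \<in> J"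
      then have "j \<noteq> i" using that by blast
      then show "B c j = A j" by (simp add: B_def)
    qed
    have smaller: "(\<Sum>j\<in>I. card (B c j)) < (\<Sum>j\<in>I. card (A j))" if "c \<in> A i" for c
    proof (rule sum_strict_mono_ex1)
      show "\<forall>j\<in>I. card (B c j) \<le> card (A j)"
        using fin by (auto simp: B_def intro: card_mono)
      have "card (B c i) < card (A i)"
        using fin[OF i(1)] that unfolding B_def by (simp add: card_Diff1_less del: card_Diff_singleton card_Diff_insert)
      then show "\<exists>j\<in>I. card (B c j) < card (A j)" using i(1) by blast
    qed (rule \<open>finite I\<close>)
    have use_less: ?thesis if c: "c \<in> A i" and ok: "\<And>J. J \<subseteq> I \<Longrightarrow> card J \<le> card (\<Union>j\<in>J. B c j)" for c
    proof -
      have finB: "finite (B c j)" if "j \<in> I" for j using fin[OF that] fin[OF i(1)] by (simp add: B_def)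
      obtain r where r: "inj_on r I" "\<And>j. j \<in> I \<Longrightarrow> r j \<in> B c j"
        using less.hyps[OF smaller[OF c] _ \<open>finite I\<close> finB ok] by blast
      moreover have "B c j \<subseteq> A j" for j by (auto simp: B_def)
      ultimately show ?thesis using less.prems(1)[of r] by blast
    qed
    have viol: "\<exists>J\<subseteq>I. i \<notin> J \<and> card (\<Union>j\<in>insert i J. B c j) \<le> card J"
      if bad: "\<not> (\<forall>J\<subseteq>I. card J \<le> card (\<Union>j\<in>J. B c j))" for c
    proof -
      obtain J where J: "J \<subseteq> I" "card (\<Union>j\<in>J. B c j) < card J"
        using bad by (meson not_le)
      have "i \<in> J"
      proof (rule ccontr)
        assume "i \<notin> J"
        from B_same[OF this] show False using hall[OF J(1)] J(2) by simp
      qed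
      then have "insert i (J - {i}) = J" by blast
      moreover have "card J = Suc (card (J - {i}))"
        using \<open>i \<in> J\<close> J(1) \<open>finite I\<close> by (meson card.remove finite_subset)
      ultimately show ?thesis using J by (intro exI[of _ "J - {i}"]) auto
    qed
    have False if bad: "\<not> (\<forall>J\<subseteq>I. card J \<le> card (\<Union>j\<in>J. B a j))"
      "\<not> (\<forall>J\<subseteq>I. card J \<le> card (\<Union>j\<in>J. B b j))"
    proof -
      obtain J where J: "J \<subseteq> I" "i \<notin> J" "card (\<Union>j\<in>insert i J. B a j) \<le> card J" using viol[OF bad(1)] by blast
      obtain K where K: "K \<subseteq> I" "i \<notin> K" "card (\<Union>j\<in>insert i K. B b j) \<le> card K" using viol[OF bad(2)] by blast
      let ?X = "\<Union>j\<in>insert i J. B a j" and ?Y = "\<Union>j\<in>insert i K. B b j"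
      have X: "?X = (A i - {a}) \<union> (\<Union>j\<in>J. A j)" and Y: "?Y = (A i - {b}) \<union> (\<Union>j\<in>K. A j)"
        unfolding UN_insert B_same[OF J(2)] B_same[OF K(2)] by (simp_all add: B_def)
      have fXY: "finite ?X" "finite ?Y"
        unfolding X Y using finU[OF J(1)] finU[OF K(1)] fin[OF i(1)] by simp_all
      have un: "?X \<union> ?Y = (\<Union>j\<in>insert i (J \<union> K). A j)"
        unfolding X Y using ab by blast
      have "card (insert i (J \<union> K)) \<le> card (?X \<union> ?Y)"
        unfolding un using J(1) K(1) i(1) by (intro hall) auto
      moreover have "card (J \<inter> K) \<le> card (\<Union>j\<in>J \<inter> K. A j)"
        using J(1) by (intro hall) auto
      moreover have "card (\<Union>j\<in>J \<inter> K. A j) \<le> card (?X \<inter> ?Y)"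
        using fXY unfolding X Y by (intro card_mono) blast+
      ultimately have "card (insert i (J \<union> K)) + card (J \<inter> K) \<le> card (?X \<union> ?Y) + card (?X \<inter> ?Y)"
        by linarith
      also have "\<dots> = card ?X + card ?Y" using card_Un_Int[OF fXY] by simp
      also have "\<dots> \<le> card J + card K" using J(3) K(3) by simp
      also have "\<dots> = card (J \<union> K) + card (J \<inter> K)"
        using card_Un_Int[OF finite_subset[OF J(1) \<open>finite I\<close>] finite_subset[OF K(1) \<open>finite I\<close>]] .
      finally show False
        using J K \<open>finite I\<close> finite_subset[of "J \<union> K" I] by simp
    qed
    then show ?thesis using use_less ab by blast
  qed
qed

text \<open>
  Splitting each \<open>s\<close> into \<open>hi s\<close> copies, a bipartite matching is wanted that covers the
  first \<open>lo s\<close> copies of every \<open>s\<close> and also all of \<open>B\<close>. Hall's theorem gives a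
  matching \<open>r1\<close> covering the copies and a matching \<open>r2\<close> covering \<open>B\<close>. They are merged as in the
  Schroeder-Bernstein theorem (the Mendelsohn-Dulmage theorem): a fixed point \<open>Z\<close> of a monotone
  map selects the elements of \<open>B\<close> that keep their partner under \<open>r2\<close>, and \<open>r1\<close> serves the rest.
\<close>

lemma loads_between_bounds:
  fixes R :: "('s \<times> 'q) set" and lo hi :: "'s \<Rightarrow> nat"
  assumes "finite S" "finite Q" "R \<subseteq> S \<times> Q" "B \<subseteq> Q"
    and lohi: "\<And>s. s \<in> S \<Longrightarrow> lo s \<le> hi s"
    and lower: "\<And>X. X \<subseteq> S \<Longrightarrow> sum lo X \<le> card (R `` X)"
    and upper: "\<And>Y. Y \<subseteq> B \<Longrightarrow> card Y \<le> sum hi (R\<inverse> `` Y)"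
  obtains A \<sigma> where "B \<subseteq> A" "A \<subseteq> Q" "\<And>q. q \<in> A \<Longrightarrow> (\<sigma> q, q) \<in> R"
    "\<And>s. s \<in> S \<Longrightarrow> lo s \<le> card {q \<in> A. \<sigma> q = s}"
    "\<And>s. s \<in> S \<Longrightarrow> card {q \<in> A. \<sigma> q = s} \<le> hi s"
proof -
  \<comment> \<open>The copies of the elements of \<^term>\<open>S\<close>, with multiplicities \<^term>\<open>h\<close>.\<close>
  define P where "P h = Sigma S (\<lambda>s. {..<h s})" for h :: "'s \<Rightarrow> nat"
  have finP: "finite (P h)" for h using \<open>finite S\<close> by (simp add: P_def)
  have P12: "P lo \<subseteq> P hi" using lohi unfolding P_def by fastforce
  have finB: "finite B" using assms(2,4) by (rule rev_finite_subset)
  obtain r1 where r1: "inj_on r1 (P lo)" "\<And>p. p \<in> P lo \<Longrightarrow> r1 p \<in> R `` {fst p}"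
  proof (rule hall_marriage[OF finP, of lo "\<lambda>p. R `` {fst p}"])
    fix p show "finite (R `` {fst p})" using assms(2,3) by (rule_tac finite_subset[of _ Q]) auto
  next
    fix J assume J: "J \<subseteq> P lo"
    have X: "fst ` J \<subseteq> S" using J by (auto simp: P_def)
    have "J \<subseteq> Sigma (fst ` J) (\<lambda>s. {..<lo s})" using J by (force simp: P_def)
    then have "card J \<le> card (Sigma (fst ` J) (\<lambda>s. {..<lo s}))"
      using X \<open>finite S\<close> by (intro card_mono) (auto intro: finite_subset)
    also have "\<dots> = sum lo (fst ` J)" using X \<open>finite S\<close> by (subst card_SigmaI) (auto intro: finite_subset)
    also have "\<dots> \<le> card (R `` (fst ` J))" by (rule lower[OF X])
    also have "R `` (fst ` J) = (\<Union>p\<in>J. R `` {fst p})" by auto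
    finally show "card J \<le> card (\<Union>p\<in>J. R `` {fst p})" .
  qed auto
  obtain r2 where r2: "inj_on r2 B" "\<And>q. q \<in> B \<Longrightarrow> r2 q \<in> Sigma (R\<inverse> `` {q}) (\<lambda>s. {..<hi s})"
  proof (rule hall_marriage[OF finB, of "\<lambda>q. Sigma (R\<inverse> `` {q}) (\<lambda>s. {..<hi s})"])
    fix q show "finite (Sigma (R\<inverse> `` {q}) (\<lambda>s. {..<hi s}))"
      using assms(1,3) by (intro finite_SigmaI) (auto intro: finite_subset[of _ S])
  next
    fix J assume J: "J \<subseteq> B"
    have "card J \<le> sum hi (R\<inverse> `` J)" by (rule upper[OF J])
    also have "\<dots> = card (Sigma (R\<inverse> `` J) (\<lambda>s. {..<hi s}))"
      using assms(1,3) by (subst card_SigmaI) (auto intro: finite_subset[of _ S])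
    also have "Sigma (R\<inverse> `` J) (\<lambda>s. {..<hi s}) = (\<Union>q\<in>J. Sigma (R\<inverse> `` {q}) (\<lambda>s. {..<hi s}))" by auto
    finally show "card J \<le> card (\<Union>q\<in>J. Sigma (R\<inverse> `` {q}) (\<lambda>s. {..<hi s}))" .
  qed auto
  \<comment> \<open>An element of \<^term>\<open>B\<close> that \<^term>\<open>r1\<close> assigns to no copy outside \<^term>\<open>r2 ` Z\<close> has to keep its partner under \<^term>\<open>r2\<close>.\<close>
  define Z where "Z = lfp (\<lambda>Z. B - r1 ` (P lo - r2 ` Z))"
  have Z: "Z = B - r1 ` (P lo - r2 ` Z)"
    unfolding Z_def by (rule lfp_unfold) (auto intro!: monoI)
  define P' where "P' = P lo - r2 ` Z"
  define A where "A = Z \<union> r1 ` P'"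
  \<comment> \<open>The copy to which an element of \<^term>\<open>A\<close> is matched.\<close>
  define \<pi> where "\<pi> q = (if q \<in> Z then r2 q else inv_into (P lo) r1 q)" for q
  have ZB: "Z \<subseteq> B" using Z by blast
  have ZP: "Z \<inter> r1 ` P' = {}" using Z unfolding P'_def by blast
  have \<pi>1: "\<pi> (r1 p) = p" if "p \<in> P'" for p
    using that ZP inv_into_f_f[OF r1(1), of p] unfolding \<pi>_def P'_def by auto
  have \<pi>Z: "\<pi> q = r2 q" if "q \<in> Z" for q using that by (simp add: \<pi>_def)
  have img: "\<pi> ` A = r2 ` Z \<union> P'"
  proof -
    have "\<pi> ` Z = r2 ` Z" using \<pi>Z by (rule image_cong[OF refl])
    moreover have "\<pi> ` r1 ` P' = P'" using \<pi>1 by (force simp: image_image)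
    ultimately show ?thesis by (simp add: A_def image_Un)
  qed
  have inj: "inj_on \<pi> A"
    unfolding A_def
  proof (rule inj_on_Un[THEN iffD2], intro conjI)
    show "inj_on \<pi> Z" using inj_on_subset[OF r2(1) ZB] \<pi>Z by (simp cong: inj_on_cong)
    show "inj_on \<pi> (r1 ` P')" using \<pi>1 by (auto intro!: inj_onI)
    have "\<pi> ` Z = r2 ` Z" using \<pi>Z by (rule image_cong[OF refl])
    moreover have "\<pi> ` r1 ` P' = P'" using \<pi>1 by (force simp: image_image)
    ultimately show "\<pi> ` (Z - r1 ` P') \<inter> \<pi> ` (r1 ` P' - Z) = {}"
      unfolding P'_def by blast
  qed
  have Rq: "(fst (\<pi> q), q) \<in> R" if q: "q \<in> A" for q
  proof (cases "q \<in> Z")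
    case True
    then have "q \<in> B" using ZB by blast
    then show ?thesis using r2(2)[of q] \<pi>Z[OF True] by (auto simp: mem_Times_iff Sigma_def)
  next
    case False
    then obtain p where p: "p \<in> P'" "q = r1 p" using q by (auto simp: A_def)
    then show ?thesis using r1(2)[of p] \<pi>1 by (auto simp: P'_def)
  qed
  have r2P: "r2 ` Z \<subseteq> P hi"
  proof (rule image_subsetI)
    fix q assume "q \<in> Z"
    then show "r2 q \<in> P hi" using r2(2)[of q] ZB assms(3) unfolding P_def by (cases "r2 q") auto
  qed
  have up: "\<pi> ` A \<subseteq> P hi" using img r2P P12 unfolding P'_def by blast
  have low: "P lo \<subseteq> \<pi> ` A" using img unfolding P'_def by blast
  have fA: "finite (\<pi> ` A)" using up finP by (rule finite_subset)
  have eq: "card {q \<in> A. fst (\<pi> q) = s} = card {p \<in> \<pi> ` A. fst p = s}" for s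
  proof -
    have "{p \<in> \<pi> ` A. fst p = s} = \<pi> ` {q \<in> A. fst (\<pi> q) = s}" by auto
    moreover have "inj_on \<pi> {q \<in> A. fst (\<pi> q) = s}" by (rule inj_on_subset[OF inj]) auto
    ultimately show ?thesis by (simp add: card_image)
  qed
  have fiber: "{p \<in> P h. fst p = s} = {s} \<times> {..<h s}" if "s \<in> S" for h s
    using that by (auto simp: P_def)
  show thesis
  proof (rule that[of A "\<lambda>q. fst (\<pi> q)"])
    show "B \<subseteq> A" using Z unfolding A_def P'_def by blast
    show "A \<subseteq> Q" using Rq assms(3) by blast
    show "(fst (\<pi> q), q) \<in> R" if "q \<in> A" for q using Rq[OF that] .
    fix s assume s: "s \<in> S"
    have "card {p \<in> P lo. fst p = s} \<le> card {p \<in> \<pi> ` A. fst p = s}"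
      using low fA by (intro card_mono) auto
    then show "lo s \<le> card {q \<in> A. fst (\<pi> q) = s}" unfolding eq fiber[OF s] by simp
    have "card {p \<in> \<pi> ` A. fst p = s} \<le> card {p \<in> P hi. fst p = s}"
      using up finP[of hi] by (intro card_mono) auto
    then show "card {q \<in> A. fst (\<pi> q) = s} \<le> hi s" unfolding eq fiber[OF s] by simp
  qed
qed

section \<open>Barriers and parity factors\<close>

text \<open>
  This is necessary for a parity factor: every odd component of \<^term>\<open>V - S\<close> must send an edge of
  the factor to \<^term>\<open>S\<close>.
\<close>

definition parity_cond :: "('a \<times> 'a) set \<Rightarrow> ('a \<Rightarrow> nat) \<Rightarrow> 'a set \<Rightarrow> bool" where
  "parity_cond E f V \<longleftrightarrow> (\<forall>S\<subseteq>V. card (ocomps E f (V - S)) \<le> sum f S)"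

definition parity_factor :: "('a \<times> 'a) set \<Rightarrow> ('a \<Rightarrow> nat) \<Rightarrow> 'a set \<Rightarrow> ('a \<times> 'a) set \<Rightarrow> bool" where
  "parity_factor E f V F \<longleftrightarrow> subgraph_on E V F \<and> (\<forall>v\<in>V. deg F v \<le> f v \<and> even (deg F v + f v))"

text \<open>
  \<^term>\<open>S\<close> maximises the deficiency \<^term>\<open>int (card (ocomps E f (V - S))) - int (sum f S)\<close>, and no proper
  superset attains the maximum. The inequalities are written with sums because subtraction of
  natural numbers truncates.
\<close>

definition strict_barrier :: "('a \<times> 'a) set \<Rightarrow> ('a \<Rightarrow> nat) \<Rightarrow> 'a set \<Rightarrow> 'a set \<Rightarrow> bool" where
  "strict_barrier E f V S \<longleftrightarrow> S \<subseteq> V \<and>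
     (\<forall>T\<subseteq>V. card (ocomps E f (V - T)) + sum f S \<le> card (ocomps E f (V - S)) + sum f T) \<and>
     (\<forall>T\<subseteq>V. S \<subset> T \<longrightarrow> card (ocomps E f (V - T)) + sum f S < card (ocomps E f (V - S)) + sum f T)"

lemma strict_barrierD:
  assumes "strict_barrier E f V S"
  shows "S \<subseteq> V"
    and "T \<subseteq> V \<Longrightarrow> card (ocomps E f (V - T)) + sum f S \<le> card (ocomps E f (V - S)) + sum f T"
    and "T \<subseteq> V \<Longrightarrow> S \<subset> T \<Longrightarrow> card (ocomps E f (V - T)) + sum f S < card (ocomps E f (V - S)) + sum f T"
  using assms unfolding strict_barrier_def by simp_all

lemma strict_barrier_exists:
  assumes "finite V"
  obtains S where "strict_barrier E f V S"
proof -
  let ?d = "\<lambda>S. int (card (ocomps E f (V - S))) - int (sum f S)"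
  define M where "M = Max (?d ` Pow V)"
  have fin: "finite (?d ` Pow V)" using assms by simp
  have le: "?d S \<le> M" if "S \<subseteq> V" for S unfolding M_def using fin that by (intro Max_ge) auto
  have "M \<in> ?d ` Pow V" unfolding M_def by (intro Max_in) (use fin in auto)
  then obtain S0 where S0: "S0 \<subseteq> V" "?d S0 = M" by auto
  have "finite {S. S \<subseteq> V \<and> ?d S = M}" using assms by simp
  moreover have "{S. S \<subseteq> V \<and> ?d S = M} \<noteq> {}" using S0 by blast
  ultimately obtain S where S: "S \<subseteq> V" "?d S = M"
    and mx: "\<And>T. T \<subseteq> V \<Longrightarrow> ?d T = M \<Longrightarrow> S \<subseteq> T \<Longrightarrow> S = T"
    using finite_has_maximal[of "{S. S \<subseteq> V \<and> ?d S = M}"] by auto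
  have "strict_barrier E f V S"
    unfolding strict_barrier_def
  proof (intro conjI allI impI S(1))
    fix T assume T: "T \<subseteq> V"
    have "?d T \<le> ?d S" using le[OF T] S(2) by simp
    then show "card (ocomps E f (V - T)) + sum f S \<le> card (ocomps E f (V - S)) + sum f T" by linarith
    assume "S \<subset> T"
    then have "?d T \<noteq> M" using mx[OF T] by blast
    then have "?d T < ?d S" using le[OF T] S(2) by linarith
    then show "card (ocomps E f (V - T)) + sum f S < card (ocomps E f (V - S)) + sum f T" by linarith
  qed
  then show thesis using that by blast
qed

lemma parity_gap:
  fixes a b c d :: nat
  shows "a = b + c \<Longrightarrow> even (c + d) \<Longrightarrow> even a \<longleftrightarrow> even (b + d)"
    and "d < b \<Longrightarrow> even (b + d) \<Longrightarrow> d + 2 \<le> b"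
  by presburger+

text \<open>
  Adding \<^term>\<open>T\<close> to the barrier replaces the odd component \<^term>\<open>K\<close> by those of \<^term>\<open>K - T\<close>, and strict
  maximality bounds their number by \<^term>\<open>sum f T\<close>. Equality is impossible by parity.
\<close>

lemma strict_barrier_odd_comp:
  assumes "sym E" "finite V" "strict_barrier E f V S"
    and K: "K \<in> ocomps E f (V - S)" and T: "T \<subseteq> K" "T \<noteq> {}"
  shows "card (ocomps E f (K - T)) + 1 \<le> sum f T"
proof -
  have Kc: "K \<in> comps E (V - S)" using K by (simp add: ocomps_def)
  have KV: "K \<subseteq> V - S" by (rule comps_subset[OF Kc])
  have fin: "finite K" "finite T" "finite S"
    using KV T(1) assms(2) strict_barrierD(1)[OF assms(3)] by (meson finite_Diff finite_subset)+
  have "V - S - T = V - (S \<union> T)" by blast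
  then have "card (ocomps E f (V - (S \<union> T))) = card (ocomps E f (K - T)) + card (ocomps E f (V - S) - {K})"
    using ocomps_delete[OF assms(1) _ Kc T(1), of f] assms(2) by simp
  moreover have "card (ocomps E f (V - S) - {K}) + 1 = card (ocomps E f (V - S))"
    using card_Suc_Diff1[OF finite_ocomps K] assms(2) by simp
  moreover have "card (ocomps E f (V - (S \<union> T))) + sum f S < card (ocomps E f (V - S)) + sum f (S \<union> T)"
    by (rule strict_barrierD(3)[OF assms(3)]) (use strict_barrierD(1)[OF assms(3)] T KV in blast)+
  moreover have "sum f (S \<union> T) = sum f S + sum f T"
    using KV T(1) fin by (intro sum.union_disjoint) auto
  ultimately have 1: "card (ocomps E f (K - T)) < 1 + sum f T" by linarith
  have "sum f K = sum f T + sum f (K - T)" using T(1) fin(1) by (metis add.commute sum.subset_diff)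
  moreover have "odd (sum f K)" using K by (simp add: ocomps_def)
  moreover have "even (sum f (K - T) + card (ocomps E f (K - T)))"
    by (rule ocomps_parity) (use assms(1) fin in auto)
  ultimately have "odd (sum f T + card (ocomps E f (K - T)))"
    using parity_gap(1)[of "sum f K"] by blast
  then have "card (ocomps E f (K - T)) \<noteq> sum f T" by auto
  then show ?thesis using 1 by linarith
qed

lemma strict_barrier_even_comp:
  assumes "sym E" "finite V" "strict_barrier E f V S"
    and K: "K \<in> comps E (V - S)" "even (sum f K)"
  shows "parity_cond E f K"
  unfolding parity_cond_def
proof (intro allI impI)
  fix T assume T: "T \<subseteq> K"
  have KV: "K \<subseteq> V - S" by (rule comps_subset[OF K(1)])
  have fin: "finite T" "finite S"
    using KV T assms(2) strict_barrierD(1)[OF assms(3)] by (meson finite_Diff finite_subset)+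
  have "V - S - T = V - (S \<union> T)" by blast
  then have "card (ocomps E f (V - (S \<union> T))) = card (ocomps E f (K - T)) + card (ocomps E f (V - S) - {K})"
    using ocomps_delete[OF assms(1) _ K(1) T, of f] assms(2) by simp
  moreover have "card (ocomps E f (V - S) - {K}) = card (ocomps E f (V - S))"
    using K(2) by (simp add: ocomps_def)
  moreover have "card (ocomps E f (V - (S \<union> T))) + sum f S \<le> card (ocomps E f (V - S)) + sum f (S \<union> T)"
    by (rule strict_barrierD(2)[OF assms(3)]) (use strict_barrierD(1)[OF assms(3)] T KV in blast)
  moreover have "sum f (S \<union> T) = sum f S + sum f T"
    using KV T fin by (intro sum.union_disjoint) auto
  ultimately show "card (ocomps E f (K - T)) \<le> sum f T" by linarith
qed

lemma sum_fun_upd_decr: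
  fixes f :: "'a \<Rightarrow> nat"
  assumes "finite A" "x \<in> A" "f x \<ge> 1"
  shows "sum (f(x := f x - 1)) A + 1 = sum f A"
proof -
  have "sum (f(x := f x - 1)) (A - {x}) = sum f (A - {x})" by (rule sum.cong) auto
  then show ?thesis using sum.remove[OF assms(1,2), of f] sum.remove[OF assms(1,2), of "f(x := f x - 1)"] assms(3)
    by simp
qed

text \<open>Only the component that contains \<^term>\<open>x\<close> changes its parity.\<close>

lemma card_ocomps_decr:
  assumes "finite V" "f x \<ge> (1::nat)"
  shows "card (ocomps E (f(x := f x - 1)) V) \<le> card (ocomps E f V) + 1"
proof -
  have eq: "sum (f(x := f x - 1)) C = sum f C" if "x \<notin> C" for C
    using that by (intro sum.cong) auto
  have "ocomps E (f(x := f x - 1)) V \<subseteq> ocomps E f V \<union> {C \<in> comps E V. x \<in> C}"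
    using eq by (auto simp: ocomps_def)
  moreover have "{C \<in> comps E V. x \<in> C} \<subseteq> {THE C. C \<in> comps E V \<and> x \<in> C}"
  proof
    fix C assume C: "C \<in> {C \<in> comps E V. x \<in> C}"
    have "(THE C. C \<in> comps E V \<and> x \<in> C) = C"
      using C comps_disjoint[of _ E V C] by (intro the_equality) blast+
    then show "C \<in> {THE C. C \<in> comps E V \<and> x \<in> C}" by simp
  qed
  ultimately have "ocomps E (f(x := f x - 1)) V \<subseteq> ocomps E f V \<union> {THE C. C \<in> comps E V \<and> x \<in> C}" by blast
  then have "card (ocomps E (f(x := f x - 1)) V) \<le> card (ocomps E f V \<union> {THE C. C \<in> comps E V \<and> x \<in> C})"
    using finite_ocomps[OF assms(1)] by (intro card_mono) auto
  also have "\<dots> \<le> card (ocomps E f V) + 1" by (metis card_Un_le card.empty card.insert empty_iff finite.emptyI One_nat_def)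
  finally show ?thesis .
qed

text \<open>
  An odd component is critical: as soon as one of its vertices, no matter which, is relieved of one
  unit of degree, the component satisfies the parity condition. Hence it can be attached to the
  barrier by a single edge at any vertex.
\<close>

lemma strict_barrier_critical:
  assumes "sym E" "finite V" "strict_barrier E f V S"
    and K: "K \<in> ocomps E f (V - S)" and x: "x \<in> K"
  shows "f x \<ge> 1" "parity_cond E (f(x := f x - 1)) K"
proof -
  note odd = strict_barrier_odd_comp[OF assms(1-3) K]
  have Kc: "K \<in> comps E (V - S)" using K by (simp add: ocomps_def)
  have fin: "finite K" using comps_subset[OF Kc] assms(2) by (meson finite_Diff finite_subset)
  show fx: "f x \<ge> 1" using odd[of "{x}"] x by simp
  show "parity_cond E (f(x := f x - 1)) K"
    unfolding parity_cond_def
  proof (intro allI impI)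
    fix T assume T: "T \<subseteq> K"
    have finT: "finite T" using T fin by (rule finite_subset)
    consider "T = {}" | "x \<in> T" | "T \<noteq> {}" "x \<notin> T" by blast
    then show "card (ocomps E (f(x := f x - 1)) (K - T)) \<le> sum (f(x := f x - 1)) T"
    proof cases
      case 1
      have "even (sum (f(x := f x - 1)) K)"
        using sum_fun_upd_decr[where f = f, OF fin x fx] K unfolding ocomps_def
        by (metis (no_types, lifting) Suc_eq_plus1 even_Suc mem_Collect_eq)
      then have "ocomps E (f(x := f x - 1)) K = {}"
        unfolding ocomps_def comps_conn[OF Kc] by auto
      then show ?thesis using 1 by simp
    next
      case 2
      have "sum (f(x := f x - 1)) C = sum f C" if "C \<in> comps E (K - T)" for C
        using comps_subset[OF that] 2 by (intro sum.cong) auto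
      then have "ocomps E (f(x := f x - 1)) (K - T) = ocomps E f (K - T)"
        by (auto simp: ocomps_def)
      then have "card (ocomps E (f(x := f x - 1)) (K - T)) = card (ocomps E f (K - T))"
        by (rule arg_cong)
      moreover have "T \<noteq> {}" using 2 by blast
      ultimately show ?thesis using odd[OF T] sum_fun_upd_decr[where f = f, OF finT 2 fx] by linarith
    next
      case 3
      have "sum (f(x := f x - 1)) T = sum f T" using 3 by (intro sum.cong) auto
      then show ?thesis
        using odd[OF T 3(1)] card_ocomps_decr[of "K - T" f x E, OF _ fx] fin by simp
    qed
  qed
qed

definition attached :: "('a \<times> 'a) set \<Rightarrow> 'a set \<Rightarrow> 'a set set \<Rightarrow> ('a \<times> 'a set) set" where
  "attached E S Q = {(s, K). s \<in> S \<and> K \<in> Q \<and> (\<exists>x\<in>K. (x, s) \<in> E)}"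

text \<open>
  If \<^term>\<open>X\<close> is taken out of the barrier, the components without a neighbour in \<^term>\<open>X\<close> survive. Since the
  deficiency cannot grow, at least \<^term>\<open>sum f X\<close> components have a neighbour in \<^term>\<open>X\<close>.
\<close>

lemma barrier_lower_load:
  assumes "sym E" "finite V" "strict_barrier E f V S" "X \<subseteq> S"
  shows "sum f X \<le> card (attached E S (ocomps E f (V - S)) `` X)"
proof -
  let ?Q = "ocomps E f (V - S)" and ?R = "attached E S (ocomps E f (V - S))"
  have SV: "S \<subseteq> V" using assms(3) by (simp add: strict_barrier_def)
  have fin: "finite S" "finite ?Q" using finite_subset[OF SV assms(2)] assms(2) by (auto intro: finite_ocomps)
  have sub: "?R `` X \<subseteq> ?Q" by (auto simp: attached_def)
  have "?Q - ?R `` X \<subseteq> ocomps E f (V - (S - X))"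
  proof
    fix K assume K: "K \<in> ?Q - ?R `` X"
    then have Kc: "conn E K" "closed_in E (V - S) K" and od: "odd (sum f K)"
      by (auto simp: ocomps_def comps_def)
    have "(x, s) \<notin> E" if "x \<in> K" "s \<in> X" for x s
      using K that assms(4) by (auto simp: attached_def)
    then have "closed_in E (V - (S - X)) K" using Kc(2) unfolding closed_in_def by blast
    then show "K \<in> ocomps E f (V - (S - X))" using Kc(1) od by (simp add: ocomps_def comps_def)
  qed
  then have "card (?Q - ?R `` X) \<le> card (ocomps E f (V - (S - X)))"
    using assms(2) by (intro card_mono finite_ocomps) auto
  moreover have "card (?Q - ?R `` X) = card ?Q - card (?R `` X)"
    using sub fin(2) by (meson card_Diff_subset finite_subset)
  moreover have "card (?R `` X) \<le> card ?Q" using sub fin(2) by (rule card_mono[rotated])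
  moreover have "card (ocomps E f (V - (S - X))) + sum f S \<le> card ?Q + sum f (S - X)"
    by (rule strict_barrierD(2)[OF assms(3)]) (use SV in blast)
  moreover have "sum f S = sum f X + sum f (S - X)" using assms(4) fin(1) by (metis add.commute sum.subset_diff)
  ultimately show ?thesis by linarith
qed

text \<open>
  The analogue of Tutte's theorem for factors whose degrees are at most \<^term>\<open>f\<close> and have the parity
  of \<^term>\<open>f\<close>. Under the condition the maximal deficiency is 0, so a nonempty barrier \<^term>\<open>S\<close> has exactly
  \<^term>\<open>sum f S\<close> odd components; they are distributed such that each \<^term>\<open>s\<close> receives \<^term>\<open>f s\<close> of them,
  and the induction hypothesis supplies factors of the components, all of which are smaller
  than \<^term>\<open>V\<close>. If the barrier is empty, every nonempty set has slack at least 2, by parity.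
  Then some value of \<^term>\<open>f\<close> may be lowered by 2, which is why the induction also counts the
  total weight.
\<close>

theorem parity_factor_exists:
  fixes f :: "'a \<Rightarrow> nat"
  assumes "sym E" "finite V" "parity_cond E f V"
  obtains F where "parity_factor E f V F"
  using assms(2,3)
proof (induction "card V + sum f V" arbitrary: V f thesis rule: less_induct)
  case less
  note fin = less.prems(2) and cond = less.prems(3)
  obtain S where S: "strict_barrier E f V S" by (rule strict_barrier_exists[OF fin])
  have SV: "S \<subseteq> V" using S by (simp add: strict_barrier_def)
  have finS: "finite S" using SV fin by (rule finite_subset)
  let ?Q = "ocomps E f (V - S)"
  have finQ: "finite ?Q" using fin by (simp add: finite_ocomps)
  have tight: "card ?Q = sum f S"
  proof (rule antisym)
    show "card ?Q \<le> sum f S" using cond SV by (simp add: parity_cond_def)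
    have "card (ocomps E f (V - {})) + sum f S \<le> card ?Q + sum f {}"
      by (rule strict_barrierD(2)[OF S]) simp
    then show "sum f S \<le> card ?Q" by simp
  qed
  show ?case
  proof (cases "S = {}")
    case True
    show ?thesis
    proof (cases "V = {}")
      case True
      then have "parity_factor E f V {}" by (simp add: parity_factor_def subgraph_on_def sym_def)
      then show ?thesis using less.prems(1) by blast
    next
      case False
      then obtain v where v: "v \<in> V" by blast
      have Q0: "?Q = {}" using tight finQ \<open>S = {}\<close> by simp
      have evV: "even (sum f V)" using ocomps_parity[OF assms(1) fin, of f] Q0 \<open>S = {}\<close> by simp
      have slack: "card (ocomps E f (V - T)) + 2 \<le> sum f T" if T: "T \<subseteq> V" "T \<noteq> {}" for T
      proof -
        have "card (ocomps E f (V - T)) < sum f T"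
          using strict_barrierD(3)[OF S T(1)] T(2) Q0 \<open>S = {}\<close> by auto
        moreover have "sum f V = sum f T + sum f (V - T)" using T(1) fin by (metis add.commute sum.subset_diff)
        moreover have "even (sum f (V - T) + card (ocomps E f (V - T)))"
          by (rule ocomps_parity) (use assms(1) fin in auto)
        ultimately show ?thesis using evV parity_gap(1)[of "sum f V"] parity_gap(2) by blast
      qed
      have fv: "f v \<ge> 2" using slack[of "{v}"] v by simp
      \<comment> \<open>Lowering by 2 keeps all parities, and the slack of 2 pays for the smaller weight.\<close>
      define g where "g = f(v := f v - 2)"
      have sum1: "sum g A + 2 = sum f A" if "finite A" "v \<in> A" for A
      proof -
        have "sum g (A - {v}) = sum f (A - {v})" unfolding g_def by (rule sum.cong) auto
        then show ?thesis using sum.remove[OF that, of f] sum.remove[OF that, of g] fv by (simp add: g_def)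
      qed
      have sum2: "sum g A = sum f A" if "v \<notin> A" for A
        unfolding g_def using that by (intro sum.cong) auto
      have par: "even (sum g A) \<longleftrightarrow> even (sum f A)" if "finite A" for A
        using sum1[OF that] sum2[of A] by (metis even_add even_numeral)
      have oc: "ocomps E g U = ocomps E f U" if "finite U" for U
        using par finite_subset[OF comps_subset that] by (auto simp: ocomps_def)
      have "parity_cond E g V"
        unfolding parity_cond_def
      proof (intro allI impI)
        fix T assume T: "T \<subseteq> V"
        have finT: "finite T" using T fin by (rule finite_subset)
        show "card (ocomps E g (V - T)) \<le> sum g T"
        proof (cases "T = {}")
          case True
          then show ?thesis using oc[OF fin] Q0 \<open>S = {}\<close> by simp
        next
          case False
          have "sum f T \<le> sum g T + 2" using sum1[OF finT] sum2[of T] by (cases "v \<in> T") auto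
          then show ?thesis using slack[OF T False] oc[of "V - T"] fin by simp
        qed
      qed
      moreover have "card V + sum g V < card V + sum f V" using sum1[OF fin v] by simp
      ultimately obtain F where F: "parity_factor E g V F"
        using less.hyps[of V g] fin by blast
      have "deg F w \<le> f w \<and> even (deg F w + f w)" if "w \<in> V" for w
      proof -
        have "deg F w \<le> g w \<and> even (deg F w + g w)" using F that by (simp add: parity_factor_def)
        then show ?thesis using fv by (cases "w = v") (auto simp: g_def)
      qed
      then have "parity_factor E f V F" using F by (simp add: parity_factor_def)
      then show ?thesis using less.prems(1) by blast
    qed
  next
    case False
    let ?R = "attached E S ?Q"
    obtain A \<sigma> where A: "A \<subseteq> ?Q" "\<And>K. K \<in> A \<Longrightarrow> (\<sigma> K, K) \<in> ?R"
      and l1: "\<And>s. s \<in> S \<Longrightarrow> f s \<le> card {K \<in> A. \<sigma> K = s}"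
      and l2: "\<And>s. s \<in> S \<Longrightarrow> card {K \<in> A. \<sigma> K = s} \<le> f s"
    proof (rule loads_between_bounds[OF finS finQ, of ?R "{}" f f])
      show "?R \<subseteq> S \<times> ?Q" by (auto simp: attached_def)
      show "sum f X \<le> card (?R `` X)" if "X \<subseteq> S" for X
        by (rule barrier_lower_load[OF assms(1) fin S that])
    qed (auto simp: subset_empty)
    have load: "card {K \<in> A. \<sigma> K = s} = f s" if "s \<in> S" for s
      using l1 l2 that by (simp add: antisym)
    have finA: "finite A" using A(1) finQ by (rule finite_subset)
    have "card A = (\<Sum>s\<in>S. card {K \<in> A. \<sigma> K = s})"
      using sum.group[of A S \<sigma> "\<lambda>_. 1::nat"] A(2) finA finS by (auto simp: attached_def image_subset_iff)
    then have "card A = card ?Q" using load tight by simp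
    \<comment> \<open>The loads exhaust all odd components because their number is exactly \<^term>\<open>sum f S\<close>.\<close>
    then have AQ: "A = ?Q" using A(1) finQ by (simp add: card_subset_eq)
    have "\<forall>K\<in>A. \<exists>x. x \<in> K \<and> (x, \<sigma> K) \<in> E" using A(2) by (auto simp: attached_def)
    then obtain x where x: "\<And>K. K \<in> A \<Longrightarrow> x K \<in> K \<and> (x K, \<sigma> K) \<in> E" by metis
    \<comment> \<open>The edge that attaches \<^term>\<open>K\<close> to the barrier accounts for one unit of degree at \<^term>\<open>x K\<close>.\<close>
    define g where "g K = (if K \<in> A then f(x K := f (x K) - 1) else f)" for K
    have "\<exists>F. parity_factor E (g K) K F" if K: "K \<in> comps E (V - S)" for K
    proof -
      have KV: "K \<subset> V" using comps_subset[OF K] False SV by blast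
      have finK: "finite K" using KV fin by (meson finite_subset psubset_imp_subset)
      have "parity_cond E (g K) K"
      proof (cases "K \<in> A")
        case True
        then show ?thesis
          using strict_barrier_critical(2)[OF assms(1) fin S _ , of K "x K"] x[OF True] AQ by (simp add: g_def)
      next
        case f: False
        then have "even (sum f K)" using AQ K by (simp add: ocomps_def)
        then show ?thesis using strict_barrier_even_comp[OF assms(1) fin S K] f by (simp add: g_def)
      qed
      moreover have "sum (g K) K \<le> sum f V"
      proof -
        have "sum (g K) K \<le> sum f K" by (rule sum_mono) (simp add: g_def)
        also have "\<dots> \<le> sum f V" using KV fin by (intro sum_mono2) auto
        finally show ?thesis .
      qed
      moreover have "card K < card V" using KV fin by (rule psubset_card_mono[rotated])
      ultimately show ?thesis using less.hyps[of K "g K"] finK by (metis add_less_le_mono)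
    qed
    then obtain Fc where Fc: "\<And>K. K \<in> comps E (V - S) \<Longrightarrow> parity_factor E (g K) K (Fc K)" by metis
    obtain F where F: "subgraph_on E V F"
      and Fd: "\<And>C v. C \<in> comps E (V - S) \<Longrightarrow> v \<in> C \<Longrightarrow> deg F v = deg (Fc C) v + (if C \<in> A \<and> v = x C then 1 else 0)"
      and FS: "\<And>s. s \<in> S \<Longrightarrow> deg F s = card {C \<in> A. \<sigma> C = s}"
    proof (rule glue_components[OF assms(1) fin SV, of Fc A \<sigma> x])
      show "subgraph_on E C (Fc C)" if "C \<in> comps E (V - S)" for C
        using Fc[OF that] by (simp add: parity_factor_def)
      show "A \<subseteq> comps E (V - S)" using A(1) by (auto simp: ocomps_def)
      show "\<sigma> C \<in> S \<and> x C \<in> C \<and> (x C, \<sigma> C) \<in> E" if "C \<in> A" for C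
        using A(2)[OF that] x[OF that] by (auto simp: attached_def)
    qed blast
    have "deg F v \<le> f v \<and> even (deg F v + f v)" if v: "v \<in> V" for v
    proof (cases "v \<in> S")
      case True
      then show ?thesis using FS load by simp
    next
      case False
      then obtain C where C: "C \<in> comps E (V - S)" "v \<in> C"
        using comps_cover[of E "V - S" v] assms(1) fin v by blast
      have d: "deg (Fc C) v \<le> g C v \<and> even (deg (Fc C) v + g C v)"
        using Fc[OF C(1)] C(2) by (simp add: parity_factor_def)
      have "f (x C) \<ge> 1" if "C \<in> A"
        using strict_barrier_critical(1)[OF assms(1) fin S, of C "x C"] x[OF that] that AQ by simp
      then show ?thesis using d Fd[OF C] unfolding g_def by (auto split: if_splits)
    qed
    then have "parity_factor E f V F" using F by (simp add: parity_factor_def)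
    then show ?thesis using less.prems(1) by blast
  qed
qed

section \<open>Factors with degrees in \<open>H_degrees\<close>\<close>

definition H_subgraph :: "nat \<Rightarrow> ('a \<times> 'a) set \<Rightarrow> 'a set \<Rightarrow> ('a \<times> 'a) set \<Rightarrow> bool" where
  "H_subgraph n E V F \<longleftrightarrow> subgraph_on E V F \<and> (\<forall>v\<in>V. deg F v \<in> H_degrees n)"

lemma H_degrees_odd: "n \<ge> 1 \<Longrightarrow> d \<le> 2 * n - 1 \<Longrightarrow> even (d + (2 * n - 1)) \<Longrightarrow> d \<in> H_degrees n"
  by (auto simp: H_degrees_def)

lemma H_subgraph_of_parity_factor:
  assumes "n \<ge> 1" "parity_factor E (\<lambda>_. 2 * n - 1) V F"
  shows "H_subgraph n E V F"
  using assms H_degrees_odd unfolding parity_factor_def H_subgraph_def by blast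

text \<open>
  At a barrier for the constant \<^term>\<open>2 * n - 1\<close>, each barrier vertex can collect at least \<^term>\<open>2 * n - 1\<close>
  odd components. The degree \<^term>\<open>2 * n\<close> gives it room for one more. An odd component that has a
  factor of its own may be left unattached, so only the remaining ones must all be served, and for
  these the assumption is Hall's condition with capacity \<^term>\<open>2 * n\<close>. With loads in
  \<^term>\<open>{2 * n - 1, 2 * n}\<close>, every barrier vertex has an admissible degree whatever the parity.
\<close>

lemma H_subgraph_of_barrier:
  assumes n: "n \<ge> 1" and "sym E" "finite V"
    and S: "strict_barrier E (\<lambda>_. 2 * n - 1) V S"
    and bad: "\<And>Y. Y \<subseteq> {K \<in> ocomps E (\<lambda>_. 2 * n - 1) (V - S). \<nexists>F. H_subgraph n E K F} \<Longrightarrow>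
      card Y \<le> 2 * n * card ((attached E S (ocomps E (\<lambda>_. 2 * n - 1) (V - S)))\<inverse> `` Y)"
  obtains F where "H_subgraph n E V F"
proof -
  let ?f = "\<lambda>_::'a. 2 * n - 1"
  let ?Q = "ocomps E ?f (V - S)"
  let ?R = "attached E S ?Q"
  let ?B = "{K \<in> ?Q. \<nexists>F. H_subgraph n E K F}"
  have SV: "S \<subseteq> V" by (rule strict_barrierD(1)[OF S])
  have finS: "finite S" using SV \<open>finite V\<close> by (rule finite_subset)
  have finQ: "finite ?Q" using \<open>finite V\<close> by (simp add: finite_ocomps)
  obtain A \<sigma> where A: "?B \<subseteq> A" "A \<subseteq> ?Q" "\<And>K. K \<in> A \<Longrightarrow> (\<sigma> K, K) \<in> ?R"
    and l1: "\<And>s. s \<in> S \<Longrightarrow> 2 * n - 1 \<le> card {K \<in> A. \<sigma> K = s}"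
    and l2: "\<And>s. s \<in> S \<Longrightarrow> card {K \<in> A. \<sigma> K = s} \<le> 2 * n"
  proof (rule loads_between_bounds[OF finS finQ, of ?R ?B ?f "\<lambda>_. 2 * n"])
    show "?R \<subseteq> S \<times> ?Q" by (auto simp: attached_def)
    show "sum ?f X \<le> card (?R `` X)" if "X \<subseteq> S" for X
      by (rule barrier_lower_load[OF assms(2,3) S that])
    show "card Y \<le> (\<Sum>s\<in>?R\<inverse> `` Y. 2 * n)" if "Y \<subseteq> ?B" for Y
      using bad[OF that] by (simp add: mult.commute)
  qed auto
  have "\<forall>K\<in>A. \<exists>x. x \<in> K \<and> (x, \<sigma> K) \<in> E" using A(3) by (auto simp: attached_def)
  then obtain x where x: "\<And>K. K \<in> A \<Longrightarrow> x K \<in> K \<and> (x K, \<sigma> K) \<in> E" by metis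
  have "\<exists>F. if K \<in> A then parity_factor E (?f(x K := ?f (x K) - 1)) K F else H_subgraph n E K F"
    if K: "K \<in> comps E (V - S)" for K
  proof -
    have finK: "finite K" using comps_subset[OF K] \<open>finite V\<close> by (meson finite_Diff finite_subset)
    consider "K \<in> A" | "K \<notin> A" "K \<in> ?Q" | "K \<notin> A" "K \<notin> ?Q" by blast
    then show ?thesis
    proof cases
      case 1
      then have "parity_cond E (?f(x K := ?f (x K) - 1)) K"
        using strict_barrier_critical(2)[OF assms(2,3) S] x A(2) by blast
      then obtain F where "parity_factor E (?f(x K := ?f (x K) - 1)) K F"
        using parity_factor_exists[OF assms(2) finK] by blast
      then show ?thesis using 1 by auto
    next
      case 2
      then have "K \<notin> ?B" using A(1) by blast
      then show ?thesis using 2 by auto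
    next
      case 3
      then have "even (sum ?f K)" using K by (simp add: ocomps_def)
      then have "parity_cond E ?f K" by (rule strict_barrier_even_comp[OF assms(2,3) S K])
      then obtain F where "parity_factor E ?f K F"
        using parity_factor_exists[OF assms(2) finK] by blast
      then show ?thesis using 3 H_subgraph_of_parity_factor[OF n] by auto
    qed
  qed
  then obtain Fc where Fc: "\<And>K. K \<in> comps E (V - S) \<Longrightarrow>
      if K \<in> A then parity_factor E (?f(x K := ?f (x K) - 1)) K (Fc K) else H_subgraph n E K (Fc K)"
    by metis
  obtain F where F: "subgraph_on E V F"
    and Fd: "\<And>C v. C \<in> comps E (V - S) \<Longrightarrow> v \<in> C \<Longrightarrow> deg F v = deg (Fc C) v + (if C \<in> A \<and> v = x C then 1 else 0)"
    and FS: "\<And>s. s \<in> S \<Longrightarrow> deg F s = card {C \<in> A. \<sigma> C = s}"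
  proof (rule glue_components[OF assms(2,3) SV, of Fc A \<sigma> x])
    show "subgraph_on E C (Fc C)" if "C \<in> comps E (V - S)" for C
      using Fc[OF that] by (auto simp: parity_factor_def H_subgraph_def split: if_splits)
    show "A \<subseteq> comps E (V - S)" using A(2) by (auto simp: ocomps_def)
    show "\<sigma> C \<in> S \<and> x C \<in> C \<and> (x C, \<sigma> C) \<in> E" if "C \<in> A" for C
      using A(3)[OF that] x[OF that] by (auto simp: attached_def)
  qed blast
  have "deg F v \<in> H_degrees n" if v: "v \<in> V" for v
  proof (cases "v \<in> S")
    case True
    then have "deg F v = 2 * n - 1 \<or> deg F v = 2 * n" using FS[OF True] l1[OF True] l2[OF True] by linarith
    then show ?thesis using n by (auto simp: H_degrees_def)
  next
    case False
    then obtain C where C: "C \<in> comps E (V - S)" "v \<in> C"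
      using comps_cover[of E "V - S" v] assms(2,3) v by blast
    show ?thesis
    proof (cases "C \<in> A")
      case True
      then have d: "deg (Fc C) v \<le> (?f(x C := ?f (x C) - 1)) v \<and> even (deg (Fc C) v + (?f(x C := ?f (x C) - 1)) v)"
        using Fc[OF C(1)] C(2) by (simp add: parity_factor_def)
      have "deg F v \<le> 2 * n - 1 \<and> even (deg F v + (2 * n - 1))"
        using d Fd[OF C] True n by (cases "v = x C") auto
      then show ?thesis using H_degrees_odd[OF n] by blast
    next
      case f: False
      then show ?thesis using Fc[OF C(1)] Fd[OF C] C(2) by (simp add: H_subgraph_def)
    qed
  qed
  then have "H_subgraph n E V F" using F by (simp add: H_subgraph_def)
  then show thesis by (rule that)
qed

lemma clique_comps:
  assumes "\<And>u v. u \<in> C \<Longrightarrow> v \<in> C \<Longrightarrow> u \<noteq> v \<Longrightarrow> (u, v) \<in> E" "W \<subseteq> C"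
  shows "comps E W \<subseteq> {W}"
proof
  fix K assume K: "K \<in> comps E W"
  obtain x where x: "x \<in> K" using comps_nonempty[OF K] by blast
  have "y \<in> K" if "y \<in> W" for y
    using comps_closedD[OF K _ x that] assms that x comps_subset[OF K] by (cases "x = y") auto
  then show "K \<in> {W}" using comps_subset[OF K] by blast
qed

text \<open>
  A star with \<^term>\<open>2 * n\<close> leaves absorbs the odd parity, and the remaining vertices are even in number
  and have a perfect matching.
\<close>

lemma clique_H_subgraph:
  assumes n: "n \<ge> 1" and "sym E" "finite C" "odd (card C)" "card C \<ge> 2 * n + 1"
    and clique: "\<And>u v. u \<in> C \<Longrightarrow> v \<in> C \<Longrightarrow> u \<noteq> v \<Longrightarrow> (u, v) \<in> E"
  obtains F where "H_subgraph n E C F"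
proof -
  obtain v where v: "v \<in> C" using assms(5) by fastforce
  have "2 * n \<le> card (C - {v})" using v assms(3,5) by simp
  then obtain L where L: "L \<subseteq> C - {v}" "card L = 2 * n" by (rule obtain_subset_with_card_n)
  define W where "W = C - {v} - L"
  have finL: "finite L" using L(1) assms(3) by (meson finite_Diff finite_subset)
  have finW: "finite W" using assms(3) by (simp add: W_def)
  have "card W = card C - 1 - 2 * n" using L v finL assms(3) by (simp add: W_def card_Diff_subset)
  then have evW: "even (card W)" using assms(4,5) by simp
  have "parity_cond E (\<lambda>_. 1) W"
    unfolding parity_cond_def
  proof (intro allI impI)
    fix T assume T: "T \<subseteq> W"
    have "ocomps E (\<lambda>_. 1) (W - T) \<subseteq> {W - T}"
      using clique_comps[of C E "W - T", OF clique] unfolding ocomps_def W_def by blast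
    then have le: "card (ocomps E (\<lambda>_. 1) (W - T)) \<le> 1"
      using card_mono[of "{W - T}"] by fastforce
    show "card (ocomps E (\<lambda>_. 1) (W - T)) \<le> sum (\<lambda>_. 1) T"
    proof (cases "T = {}")
      case True
      have "even (card (ocomps E (\<lambda>_. 1) W))"
        using ocomps_parity[OF assms(2) finW, of "\<lambda>_. 1"] evW by simp
      then show ?thesis using le True by (cases "card (ocomps E (\<lambda>_. 1) W)") auto
    next
      case False
      then have "card T \<ge> 1" using finite_subset[OF T finW] by (simp add: Suc_le_eq card_gt_0_iff)
      then show ?thesis using le by simp
    qed
  qed
  then obtain M where M: "parity_factor E (\<lambda>_. 1) W M"
    by (rule parity_factor_exists[OF assms(2) finW])
  have MW: "M \<subseteq> E \<inter> W \<times> W" "sym M" using M by (simp_all add: parity_factor_def subgraph_on_def)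
  have M1: "card (M `` {w}) = 1" if "w \<in> W" for w
  proof -
    have "card (M `` {w}) \<le> 1 \<and> even (card (M `` {w}) + 1)"
      using M that by (simp add: parity_factor_def deg_def)
    then show ?thesis by presburger
  qed
  define F where "F = M \<union> {v} \<times> L \<union> L \<times> {v}"
  have "F \<subseteq> E \<inter> C \<times> C" using MW L(1) v clique by (auto simp: F_def W_def)
  moreover have "sym F" using MW(2) by (auto simp: F_def sym_def)
  moreover have "deg F w \<in> H_degrees n" if w: "w \<in> C" for w
  proof -
    consider "w = v" | "w \<in> L" | "w \<in> W" using w by (auto simp: W_def)
    then show ?thesis
    proof cases
      case 1
      have "F `` {w} = L" using 1 MW(1) L(1) by (auto simp: F_def W_def)
      then show ?thesis using L(2) by (simp add: deg_def H_degrees_def)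
    next
      case 2
      have "F `` {w} = {v}" using 2 MW(1) L(1) by (auto simp: F_def W_def)
      then show ?thesis using n by (simp add: deg_def H_degrees_def)
    next
      case 3
      have "F `` {w} = M `` {w}" using 3 L(1) by (auto simp: F_def W_def)
      then show ?thesis using M1[OF 3] n by (simp add: deg_def H_degrees_def)
    qed
  qed
  ultimately have "H_subgraph n E C F" by (simp add: H_subgraph_def subgraph_on_def)
  then show thesis by (rule that)
qed

lemma two_smallest:
  fixes h :: "'b \<Rightarrow> nat"
  assumes "finite Y" "card Y \<ge> 2"
  obtains C1 C2 where "C1 \<in> Y" "C2 \<in> Y" "C1 \<noteq> C2" "h C1 \<le> h C2" "h C1 + (card Y - 1) * h C2 \<le> sum h Y"
proof -
  obtain C1 where C1: "C1 \<in> Y" "\<And>K. K \<in> Y \<Longrightarrow> h C1 \<le> h K"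
    using ex_min_if_finite[of "h ` Y"] assms by (metis (no_types, lifting) arg_min_if_finite(1) arg_min_least card.empty not_numeral_le_zero)
  have c: "card (Y - {C1}) = card Y - 1" using C1(1) assms(1) by simp
  then have ne: "Y - {C1} \<noteq> {}" using assms(2) by (metis card.empty diff_is_0_eq not_one_le_zero numeral_le_one_iff one_le_numeral order_trans semiring_norm(69))
  define C2 where "C2 = arg_min_on h (Y - {C1})"
  have C2: "C2 \<in> Y - {C1}" "\<And>K. K \<in> Y - {C1} \<Longrightarrow> h C2 \<le> h K"
    using arg_min_if_finite(1)[OF _ ne, of h] arg_min_least[OF _ ne, of _ h] assms(1) unfolding C2_def by auto
  have "(card Y - 1) * h C2 \<le> sum h (Y - {C1})"
    using sum_bounded_below[of "Y - {C1}" "h C2" h] C2(2) c by simp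
  then have "h C1 + (card Y - 1) * h C2 \<le> sum h Y" using sum.remove[OF assms(1) C1(1), of h] by simp
  then show thesis using that[of C1 C2] C1 C2 by blast
qed

text \<open>
  With \<^term>\<open>c1 = c2\<close> and \<^term>\<open>U + 2 = c1 + c2 + t\<close>, the difference of the two sides is at least
  \<^term>\<open>4 * n * (t - 2) * (c2 - 1) + (t - 2)\<close>, and it only grows as \<^term>\<open>c1\<close> drops below \<^term>\<open>c2\<close>.
\<close>

lemma two_components_arithmetic:
  fixes n t c1 c2 g U :: nat
  assumes "n \<ge> 1" "t \<ge> 2" "c1 \<ge> 1" "c1 \<le> c2"
    and "t + c1 + 2 * n * t * c2 \<le> g" "U + 2 \<le> c1 + c2 + t"
  shows "(4 * n + 1) * U + 4 \<le> 2 * g"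
proof -
  obtain \<nu> \<tau> \<gamma> \<delta> where e: "n = 1 + \<nu>" "t = 2 + \<tau>" "c1 = 1 + \<gamma>" "c2 = 1 + \<gamma> + \<delta>"
    using assms(1-4) by (metis le_iff_add)
  have "U \<le> 2 * \<gamma> + \<delta> + 2 + \<tau>" using assms(6) unfolding e by linarith
  then have "(4 * n + 1) * U + 4 \<le> (4 * n + 1) * (2 * \<gamma> + \<delta> + 2 + \<tau>) + 4"
    by (intro add_right_mono mult_left_mono) auto
  also have "\<dots> \<le> 2 * (t + c1 + 2 * n * t * c2)"
    unfolding e by (simp add: algebra_simps)
  also have "\<dots> \<le> 2 * g" by (rule mult_le_mono2[OF assms(5)])
  finally show ?thesis .
qed

section \<open>The neighbourhood condition\<close>

text \<open>
  This is the only use of the neighbourhood condition. Suppose that more than \<^term>\<open>2 * n * t\<close> odd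
  components without a factor have only \<^term>\<open>t\<close> neighbours in the barrier, and let \<open>C1\<close>, \<open>C2\<close> be the
  two smallest of them. Vertices \<open>u\<close> of \<open>C1\<close> and \<open>w\<close> of \<open>C2\<close> are not adjacent and have
  at most \<open>card C1 + card C2 + t - 2\<close> neighbours, while \<open>g\<close> is at least
  \<open>t + card C1 + 2 * n * t * card C2\<close>. For \<open>t \<ge> 2\<close> the second bound on the
  neighbourhoods is then violated. For \<open>t = 1\<close> the third bound forces \<open>C2\<close> to have at least
  \<open>2 * n + 1\<close> vertices, and the first bound forces it to be a clique, so that \<open>C2\<close> has a factor
  after all. For \<open>t = 0\<close> the graph itself would have an odd component.
\<close>

lemma barrier_upper_load:
  fixes E :: "('a \<times> 'a) set" and n g :: nat
  assumes n: "n \<ge> 1" and E: "sym E" "irrefl E" "E \<subseteq> V \<times> V" and V: "finite V" "g = card V"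
    and even_comps: "\<And>C. C \<in> comps E V \<Longrightarrow> even (card C)"
    and nbr1: "\<And>u v. u \<in> V \<Longrightarrow> v \<in> V \<Longrightarrow> u \<noteq> v \<Longrightarrow> (u, v) \<notin> E \<Longrightarrow>
      g < 2 * n * (card (E `` {u} \<union> E `` {v}) + 1) + 2"
    and nbr2: "\<And>u v. u \<in> V \<Longrightarrow> v \<in> V \<Longrightarrow> u \<noteq> v \<Longrightarrow> (u, v) \<notin> E \<Longrightarrow>
      2 * g < (4 * n + 1) * card (E `` {u} \<union> E `` {v}) + 4"
    and nbr3: "\<And>u v. u \<in> V \<Longrightarrow> v \<in> V \<Longrightarrow> u \<noteq> v \<Longrightarrow> (u, v) \<notin> E \<Longrightarrow>
      4 * n < card (E `` {u} \<union> E `` {v}) + 3"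
    and S: "S \<subseteq> V"
    and Y: "Y \<subseteq> {K \<in> ocomps E (\<lambda>_. 2 * n - 1) (V - S). \<nexists>F. H_subgraph n E K F}"
  shows "card Y \<le> 2 * n * card ((attached E S (ocomps E (\<lambda>_. 2 * n - 1) (V - S)))\<inverse> `` Y)"
proof (rule ccontr)
  let ?Q = "ocomps E (\<lambda>_. 2 * n - 1) (V - S)"
  define N where "N = (attached E S ?Q)\<inverse> `` Y"
  define t where "t = card N"
  assume "\<not> ?thesis"
  then have big: "card Y \<ge> 2 * n * t + 1" unfolding t_def N_def by linarith
  have YC: "K \<in> comps E (V - S)" "odd (card K)" "\<nexists>F. H_subgraph n E K F" if "K \<in> Y" for K
  proof -
    show "K \<in> comps E (V - S)" "\<nexists>F. H_subgraph n E K F" using that Y by (auto simp: ocomps_def)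
    have "odd (card K * (2 * n - 1))" using that Y by (auto simp: ocomps_def)
    then show "odd (card K)" by simp
  qed
  have YV: "K \<subseteq> V - S" if "K \<in> Y" for K by (rule comps_subset[OF YC(1)[OF that]])
  have finK: "finite K" if "K \<in> Y" for K using YV[OF that] V(1) by (meson finite_Diff finite_subset)
  have finY: "finite Y" using YC(1) finite_comps[of "V - S" E] V(1) by (meson finite_Diff finite_subset subsetI)
  have NS: "N \<subseteq> S" by (auto simp: N_def attached_def)
  have finN: "finite N" using NS S V(1) by (meson finite_subset)
  have nbrs: "E `` {u} \<subseteq> (K - {u}) \<union> N" if K: "K \<in> Y" "u \<in> K" for K u
  proof
    fix w assume "w \<in> E `` {u}"
    then have uw: "(u, w) \<in> E" by simp
    have "w \<noteq> u" using uw E(2) by (auto simp: irrefl_def)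
    moreover have "w \<in> V" using uw E(3) by blast
    moreover have "w \<in> K" if "w \<in> V - S"
      using comps_closedD[OF YC(1)[OF K(1)] uw K(2) that] .
    moreover have "w \<in> N" if "w \<in> S"
    proof -
      have "K \<in> ?Q" using K(1) Y by blast
      then show ?thesis using that uw K unfolding N_def attached_def by blast
    qed
    ultimately show "w \<in> (K - {u}) \<union> N" by blast
  qed
  have t1: "t \<ge> 1"
  proof (rule ccontr)
    assume "\<not> t \<ge> 1"
    then have N0: "N = {}" using finN by (simp add: t_def Suc_le_eq card_gt_0_iff)
    obtain K where K: "K \<in> Y" using big by fastforce
    have "closed_in E V K"
      using nbrs[OF K] N0 YV[OF K] unfolding closed_in_def by blast
    moreover have "conn E K" using YC(1)[OF K] by (simp add: comps_def)
    ultimately show False using even_comps[of K] YC(2)[OF K] by (simp add: comps_def)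
  qed
  have "2 * n * t \<ge> 1" using n t1 by simp
  then obtain C1 C2 where C: "C1 \<in> Y" "C2 \<in> Y" "C1 \<noteq> C2" "card C1 \<le> card C2"
    and sum: "card C1 + (card Y - 1) * card C2 \<le> sum card Y"
    using two_smallest[OF finY, of card] big by (metis (no_types, lifting) Suc_1 Suc_eq_plus1 Suc_le_mono order_trans)
  define c1 c2 where "c1 = card C1" "c2 = card C2"
  have cc: "c1 \<le> c2" using C(4) by (simp add: c1_c2_def)
  have c1: "c1 \<ge> 1" using YC(2)[OF C(1)] unfolding c1_c2_def by (cases "card C1") auto
  have disj: "C1 \<inter> C2 = {}" using comps_disjoint[OF YC(1)[OF C(1)] YC(1)[OF C(2)] C(3)] .
  \<comment> \<open>All components in \<^term>\<open>Y\<close> except \<^term>\<open>C1\<close> have at least \<^term>\<open>c2\<close> vertices.\<close>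
  have g: "t + c1 + 2 * n * t * c2 \<le> g"
  proof -
    have "sum card Y = card (\<Union>Y)"
      using finK comps_disjoint[OF YC(1) YC(1)] by (intro card_Union_disjoint[symmetric]) (auto simp: pairwise_def disjnt_def)
    moreover have "card (\<Union>Y) + t = card (\<Union>Y \<union> N)"
      using finK finY finN YV NS unfolding t_def by (subst card_Un_disjoint) auto
    moreover have "card (\<Union>Y \<union> N) \<le> g"
      unfolding V(2) using YV NS S V(1) by (intro card_mono) auto
    moreover have "2 * n * t * c2 \<le> (card Y - 1) * c2" using big by (intro mult_right_mono) auto
    ultimately show ?thesis using sum unfolding c1_c2_def by linarith
  qed
  obtain u w where uw: "u \<in> C1" "w \<in> C2"
    using comps_nonempty[OF YC(1)[OF C(1)]] comps_nonempty[OF YC(1)[OF C(2)]] by blast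
  have uwE: "u \<in> V" "w \<in> V" "u \<noteq> w" "(u, w) \<notin> E"
    using uw YV[OF C(1)] YV[OF C(2)] disj nbrs[OF C(1) uw(1)] NS by blast+
  define U where "U = card (E `` {u} \<union> E `` {w})"
  have U: "U + 2 \<le> c1 + c2 + t"
  proof -
    have "E `` {u} \<union> E `` {w} \<subseteq> (C1 - {u}) \<union> (C2 - {w}) \<union> N"
      using nbrs[OF C(1) uw(1)] nbrs[OF C(2) uw(2)] by blast
    then have "U \<le> card ((C1 - {u}) \<union> (C2 - {w}) \<union> N)"
      unfolding U_def using finK C finN by (intro card_mono) auto
    also have "\<dots> \<le> card (C1 - {u}) + card (C2 - {w}) + t"
      unfolding t_def by (meson add_right_mono card_Un_le order_trans)
    also have "\<dots> = (c1 - 1) + (c2 - 1) + t"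
      using uw finK C by (simp add: c1_c2_def)
    finally show ?thesis using c1 cc by linarith
  qed
  show False
  proof (cases "t \<ge> 2")
    case True
    have "(4 * n + 1) * U + 4 \<le> 2 * g"
      by (rule two_components_arithmetic[OF n True c1 cc g U])
    then show False using nbr2[OF uwE] unfolding U_def by linarith
  next
    case False
    then have t: "t = 1" using t1 by simp
    have "4 * n < U + 3" using nbr3[OF uwE] by (simp add: U_def)
    then have "c2 \<ge> 2 * n" using U t cc by linarith
    moreover have "odd c2" using YC(2)[OF C(2)] by (simp add: c1_c2_def)
    ultimately have c2: "c2 \<ge> 2 * n + 1" by (metis Suc_eq_plus1 dvd_triv_left le_neq_implies_less Suc_leI)
    \<comment> \<open>Two non-adjacent vertices of \<^term>\<open>C2\<close> would have at most \<^term>\<open>c2 - 1\<close> neighbours in total.\<close>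
    have clique: "(a, b) \<in> E" if ab: "a \<in> C2" "b \<in> C2" "a \<noteq> b" for a b
    proof (rule ccontr)
      assume nE: "(a, b) \<notin> E"
      let ?X = "E `` {a} \<union> E `` {b}"
      have nE': "(b, a) \<notin> E" using nE E(1) by (meson symD)
      have "?X \<subseteq> (C2 - {a, b}) \<union> N"
        using nbrs[OF C(2) ab(1)] nbrs[OF C(2) ab(2)] nE nE' by blast
      then have "card ?X \<le> card ((C2 - {a, b}) \<union> N)"
        using finK[OF C(2)] finN by (intro card_mono) auto
      also have "\<dots> \<le> card (C2 - {a, b}) + t" unfolding t_def by (rule card_Un_le)
      also have "card (C2 - {a, b}) = c2 - 2"
        using ab finK[OF C(2)] by (simp add: c1_c2_def card_Diff_subset)
      finally have "card ?X + 1 \<le> c2" using t c2 n by linarith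
      then have "2 * n * (card ?X + 1) \<le> 2 * n * c2" by (rule mult_le_mono2)
      moreover have "g < 2 * n * (card ?X + 1) + 2"
        using ab YV[OF C(2)] nE by (intro nbr1) auto
      moreover have "1 + c1 + 2 * n * c2 \<le> g" using g t by simp
      ultimately show False using c1 by linarith
    qed
    have "\<exists>F. H_subgraph n E C2 F"
      using clique_H_subgraph[OF n E(1) finK[OF C(2)] YC(2)[OF C(2)] _ clique] c2 by (metis c1_c2_def(2))
    then show False using YC(3)[OF C(2)] by blast
  qed
qed

section \<open>Transfer to digraphs\<close>

text \<open>
  The vertices reachable inside \<^term>\<open>C\<close> from one of its vertices form a closed set, so they exhaust
  \<^term>\<open>C\<close>. Conversely, no path leaves a closed set, which gives maximality.
\<close>

lemma component_of_comps:
  assumes "graph G" and C: "C \<in> comps (arcs_ends G) (verts G)"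
  shows "G \<restriction> C \<in> components G"
proof -
  interpret graph G by fact
  let ?E = "arcs_ends G"
  have CV: "C \<subseteq> verts G" by (rule comps_subset[OF C])
  have sym: "sym ?E" using sym_arcs by (simp add: symmetric_def)
  have sub: "subgraph (G \<restriction> C) G"
    using CV by (intro induced_imp_subgraph induced_induce)
  have symH: "sym (arcs_ends H)" if "H = G \<restriction> C" for H
    using sym unfolding that sym_def arcs_ends_conv by fastforce
  have conn: "Digraph_Component.connected (G \<restriction> C)"
    unfolding connected_conv
  proof (intro conjI ballI)
    show "verts (G \<restriction> C) \<noteq> {}" using comps_nonempty[OF C] by simp
    fix u v assume u: "u \<in> verts (G \<restriction> C)" and v: "v \<in> verts (G \<restriction> C)"
    let ?R = "rtrancl_on (verts (G \<restriction> C)) ((arcs_ends (G \<restriction> C))\<^sup>s)"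
    define D where "D = {w \<in> C. (u, w) \<in> ?R}"
    have "closed_in ?E C D"
      unfolding closed_in_def
    proof (intro conjI allI impI)
      show "D \<subseteq> C" by (auto simp: D_def)
      fix x y assume xy: "(x, y) \<in> ?E" "x \<in> D" "y \<in> C"
      have "(x, y) \<in> arcs_ends (G \<restriction> C)"
        using xy unfolding D_def arcs_ends_conv by auto
      then have "(u, y) \<in> ?R"
        using xy unfolding D_def by (auto intro: rtrancl_on_into_rtrancl_on simp: symcl_def)
      then show "y \<in> D" using xy(3) by (simp add: D_def)
    qed
    moreover have "u \<in> D" using u by (auto simp: D_def)
    ultimately have "D = C" using C unfolding comps_def conn_def by blast
    then show "(u, v) \<in> ?R" using v by (auto simp: D_def)
  qed
  have "H = G \<restriction> C" if H: "subgraph (G \<restriction> C) H" "subgraph H G" "Digraph_Component.connected H" for H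
  proof -
    have t: "tail H = tail G" "head H = head G" and aH: "arcs H \<subseteq> arcs G"
      using H(2) by (auto simp: subgraph_def compatible_def)
    interpret H: wf_digraph H using H(2) by (simp add: subgraph_def)
    have EH: "arcs_ends H \<subseteq> ?E" using aH t by (auto simp: arcs_ends_conv)
    obtain u where u: "u \<in> C" using comps_nonempty[OF C] by blast
    have CH: "C \<subseteq> verts H" using H(1) by (auto simp: subgraph_def)
    have "v \<in> C" if v: "v \<in> verts H" for v
    proof -
      have "(u, v) \<in> rtrancl_on (verts H) ((arcs_ends H)\<^sup>s)"
        using H(3) u v CH unfolding connected_conv by blast
      then show ?thesis
      proof (induction rule: rtrancl_on_induct)
        case base
        then show ?case using u by simp
      next
        case (step y z)
        have "(y, z) \<in> ?E" using step EH sym by (auto simp: symcl_def dest: symD)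
        then show ?case using comps_closedD[OF C _ step.IH] adj_in_verts by blast
      qed
    qed
    then have vH: "verts H = C" using CH by blast
    have "arcs H = arcs (G \<restriction> C)"
    proof
      show "arcs H \<subseteq> arcs (G \<restriction> C)"
        using aH H.wellformed vH t by auto
      show "arcs (G \<restriction> C) \<subseteq> arcs H" using H(1) by (auto simp: subgraph_def)
    qed
    then show "H = G \<restriction> C" using vH t by (intro pre_digraph.equality) auto
  qed
  then show ?thesis
    using sub conn unfolding components_def max_subgraph_def by blast
qed

lemma H_factor_of_H_subgraph:
  assumes "graph G" and F: "H_subgraph n (arcs_ends G) (verts G) F"
  shows "H_factor n G (G\<lparr>arcs := {a \<in> arcs G. (tail G a, head G a) \<in> F}\<rparr>)"
proof -
  interpret graph G by fact
  let ?H = "G\<lparr>arcs := {a \<in> arcs G. (tail G a, head G a) \<in> F}\<rparr>"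
  have FE: "F \<subseteq> arcs_ends G" and symF: "sym F"
    using F by (auto simp: H_subgraph_def subgraph_on_def)
  have ends: "arcs_ends ?H = F" using FE by (auto simp: arcs_ends_conv)
  have wf: "wf_digraph ?H" by unfold_locales auto
  interpret H: wf_digraph ?H by (rule wf)
  have "graph ?H"
    by unfold_locales
      (use finite_verts finite_arcs no_loops no_multi_arcs ends symF in
        \<open>auto simp: symmetric_def arc_to_ends_def\<close>)
  moreover have "spanning ?H G"
    using wf wf_digraph by (auto simp: spanning_def subgraph_def compatible_def)
  moreover have "out_degree ?H v = deg F v" for v
  proof -
    have "F `` {v} = head G ` out_arcs ?H v"
      using ends by (force simp: arcs_ends_conv out_arcs_def)
    moreover have "inj_on (head G) (out_arcs ?H v)"
      by (rule inj_onI) (auto simp: out_arcs_def arc_to_ends_def intro: no_multi_arcs)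
    ultimately show ?thesis by (simp add: out_degree_def deg_def card_image)
  qed
  ultimately show ?thesis using F by (simp add: H_factor_def H_subgraph_def)
qed

theorem theorem3p1:
  fixes G :: "('a, 'b) pre_digraph" and n g :: nat
  assumes "n \<ge> 2"
    and "graph G"
    and "odd_components G = {}"
    and "g = card (verts G)"
    and "\<And>u v. \<lbrakk>u \<in> verts G; v \<in> verts G; u \<noteq> v; \<not> u \<rightarrow>\<^bsub>G\<^esub> v\<rbrakk> \<Longrightarrow>
      real (card (neighbours G u \<union> neighbours G v)) >
        Max {(real g - 2) / (2 * real n) - 1,
             (2 * real g - 4) / (4 * real n + 1),
             (real g - 1) / (2 * real n + 1),
             4 * real n - 3}"
  shows "\<exists>F. H_factor n G F"
proof -
  interpret graph G by fact
  let ?E = "arcs_ends G" and ?V = "verts G"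
  have n: "n \<ge> 1" using assms(1) by simp
  have E: "sym ?E" "irrefl ?E" "?E \<subseteq> ?V \<times> ?V"
    using sym_arcs adj_not_same adj_in_verts by (auto simp: symmetric_def irrefl_def)
  have nbr: "real g - 2 < 2 * real n * (real U + 1)" "2 * real g - 4 < (4 * real n + 1) * real U"
    "4 * real n - 3 < real U"
    if uv: "u \<in> ?V" "v \<in> ?V" "u \<noteq> v" "(u, v) \<notin> ?E" and U: "U = card (?E `` {u} \<union> ?E `` {v})" for u v U
  proof -
    have "neighbours G w = ?E `` {w}" for w by (auto simp: neighbours_def)
    then have a: "real U > (real g - 2) / (2 * real n) - 1"
      and b: "real U > (2 * real g - 4) / (4 * real n + 1)" and "real U > 4 * real n - 3"
      using assms(5)[OF uv] U by simp_all
    then show "4 * real n - 3 < real U" by simp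
    have "(real g - 2) / (2 * real n) < real U + 1" using a by simp
    then show "real g - 2 < 2 * real n * (real U + 1)" using n by (simp add: divide_less_eq mult.commute)
    show "2 * real g - 4 < (4 * real n + 1) * real U" using b by (simp add: divide_less_eq mult.commute)
  qed
  have even_comps: "even (card C)" if "C \<in> comps ?E ?V" for C
    using component_of_comps[OF assms(2) that] assms(3) by (auto simp: odd_components_def)
  obtain S where S: "strict_barrier ?E (\<lambda>_. 2 * n - 1) ?V S"
    using strict_barrier_exists[OF finite_verts] .
  have "card Y \<le> 2 * n * card ((attached ?E S (ocomps ?E (\<lambda>_. 2 * n - 1) (?V - S)))\<inverse> `` Y)"
    if Y: "Y \<subseteq> {K \<in> ocomps ?E (\<lambda>_. 2 * n - 1) (?V - S). \<nexists>F. H_subgraph n ?E K F}" for Y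
  proof (rule barrier_upper_load[OF n E finite_verts assms(4) even_comps _ _ _ strict_barrierD(1)[OF S] Y])
    fix u v assume uv: "u \<in> ?V" "v \<in> ?V" "u \<noteq> v" "(u, v) \<notin> ?E"
    let ?U = "card (?E `` {u} \<union> ?E `` {v})"
    have "real g < real (2 * n * (?U + 1) + 2)" using nbr(1)[OF uv refl] by (simp add: algebra_simps)
    then show "g < 2 * n * (?U + 1) + 2" by (simp only: of_nat_less_iff)
    have "real (2 * g) < real ((4 * n + 1) * ?U + 4)" using nbr(2)[OF uv refl] by (simp add: algebra_simps)
    then show "2 * g < (4 * n + 1) * ?U + 4" by (simp only: of_nat_less_iff)
    have "real (4 * n) < real (?U + 3)" using nbr(3)[OF uv refl] by simp
    then show "4 * n < ?U + 3" by (simp only: of_nat_less_iff)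
  qed
  then obtain F where "H_subgraph n ?E ?V F"
    using H_subgraph_of_barrier[OF n E(1) finite_verts S] by blast
  then show ?thesis using H_factor_of_H_subgraph[OF assms(2)] by blast
qed

end
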